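(* Let $R$ be a local right perfect ring. A right $R$-module $M$ is simple-direct-projective if and only if $M$ is semisimple or $\mathrm{soc}(M)\subseteq \mathrm{rad}(M)$.
   Context: Rings are associative with unity and modules are unitary. A (not necessarily commutative) ring is local if it has a unique maximal right ideal, and right perfect if every right module over it has a projective cover. A right module $M$ is simple-direct-projective if, whenever $A$ and $B$ are submodules of $M$ with $B$ simple, $M/A\cong B$ and $B$ a direct summand of $M$, then $A$ is a direct summand of $M$. $\mathrm{soc}(M)$ is the sum of all simple submodules of $M$; $\mathrm{rad}(M)$ is the intersection of all maximal submodules of $M$ (equal to $M$ if there are none). *)

theory Defs
  imports "HOL-Algebra.AbelCoset" "HOL-Algebra.Module" "HOL-Library.Equipollence"
begin

text \<open>
  The library's module locale is restricted to commutative rings, so right modules over arbitrary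
  rings are introduced here on top of the library's module record. Although the library writes
  scalars on the left, \<open>a \<odot>\<^bsub>M\<^esub> x\<close> denotes the right action usually written \<open>xa\<close>; hence the order
  of the factors in \<open>ract_assoc\<close>. The library's locale \<open>submodule\<close> (additive subgroup closed under
  the action) involves neither commutativity nor the side of the action and is used unchanged.
\<close>

locale right_module = R?: ring R + M?: abelian_group M
  for R :: "('a, 'c) ring_scheme" (structure)
    and M :: "('a, 'b, 'd) module_scheme" (structure) +
  assumes ract_closed:
      "\<lbrakk>a \<in> carrier R; x \<in> carrier M\<rbrakk> \<Longrightarrow> a \<odot>\<^bsub>M\<^esub> x \<in> carrier M"
    and ract_l_distr:
      "\<lbrakk>a \<in> carrier R; b \<in> carrier R; x \<in> carrier M\<rbrakk> \<Longrightarrow>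
        (a \<oplus>\<^bsub>R\<^esub> b) \<odot>\<^bsub>M\<^esub> x = a \<odot>\<^bsub>M\<^esub> x \<oplus>\<^bsub>M\<^esub> b \<odot>\<^bsub>M\<^esub> x"
    and ract_r_distr:
      "\<lbrakk>a \<in> carrier R; x \<in> carrier M; y \<in> carrier M\<rbrakk> \<Longrightarrow>
        a \<odot>\<^bsub>M\<^esub> (x \<oplus>\<^bsub>M\<^esub> y) = a \<odot>\<^bsub>M\<^esub> x \<oplus>\<^bsub>M\<^esub> a \<odot>\<^bsub>M\<^esub> y"
    and ract_assoc:
      "\<lbrakk>a \<in> carrier R; b \<in> carrier R; x \<in> carrier M\<rbrakk> \<Longrightarrow>
        (a \<otimes>\<^bsub>R\<^esub> b) \<odot>\<^bsub>M\<^esub> x = b \<odot>\<^bsub>M\<^esub> (a \<odot>\<^bsub>M\<^esub> x)"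
    and ract_one:
      "x \<in> carrier M \<Longrightarrow> \<one>\<^bsub>R\<^esub> \<odot>\<^bsub>M\<^esub> x = x"

definition rmod_hom ::
  "('a, 'c) ring_scheme \<Rightarrow> ('a, 'b, 'd) module_scheme \<Rightarrow> ('a, 'e, 'f) module_scheme \<Rightarrow> ('b \<Rightarrow> 'e) set"
  where "rmod_hom R M N =
    {h \<in> hom (add_monoid M) (add_monoid N).
      \<forall>a\<in>carrier R. \<forall>x\<in>carrier M. h (a \<odot>\<^bsub>M\<^esub> x) = a \<odot>\<^bsub>N\<^esub> h x}"

definition rmod_isomorphic ::
  "('a, 'c) ring_scheme \<Rightarrow> ('a, 'b, 'd) module_scheme \<Rightarrow> ('a, 'e, 'f) module_scheme \<Rightarrow> bool"
  where "rmod_isomorphic R M N \<longleftrightarrow> (\<exists>h\<in>rmod_hom R M N. bij_betw h (carrier M) (carrier N))"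

text \<open>The multiplicative fields of the module record are irrelevant.\<close>

definition quot_module :: "('a, 'b, 'd) module_scheme \<Rightarrow> 'b set \<Rightarrow> ('a, 'b set) module"
  where "quot_module M A =
    \<lparr>carrier = a_rcosets\<^bsub>M\<^esub> A, monoid.mult = undefined, one = undefined,
     zero = A, add = set_add M, smult = (\<lambda>a X. \<Union>x\<in>X. A +>\<^bsub>M\<^esub> (a \<odot>\<^bsub>M\<^esub> x))\<rparr>"

definition right_regular :: "('a, 'c) ring_scheme \<Rightarrow> ('a, 'a) module"
  where "right_regular R =
    \<lparr>carrier = carrier R, monoid.mult = monoid.mult R, one = one R,
     zero = zero R, add = add R, smult = (\<lambda>a x. x \<otimes>\<^bsub>R\<^esub> a)\<rparr>"

definition simple_rmodule :: "('a, 'c) ring_scheme \<Rightarrow> ('a, 'b, 'd) module_scheme \<Rightarrow> bool"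
  where "simple_rmodule R M \<longleftrightarrow>
    right_module R M \<and> carrier M \<noteq> {\<zero>\<^bsub>M\<^esub>} \<and>
    (\<forall>N. submodule N R M \<longrightarrow> N = {\<zero>\<^bsub>M\<^esub>} \<or> N = carrier M)"

definition simple_submodule :: "'b set \<Rightarrow> ('a, 'c) ring_scheme \<Rightarrow> ('a, 'b, 'd) module_scheme \<Rightarrow> bool"
  where "simple_submodule B R M \<longleftrightarrow> submodule B R M \<and> simple_rmodule R (M\<lparr>carrier := B\<rparr>)"

definition maximal_submodule :: "'b set \<Rightarrow> ('a, 'c) ring_scheme \<Rightarrow> ('a, 'b, 'd) module_scheme \<Rightarrow> bool"
  where "maximal_submodule N R M \<longleftrightarrow>
    submodule N R M \<and> N \<noteq> carrier M \<and>
    (\<forall>L. submodule L R M \<and> N \<subseteq> L \<longrightarrow> L = N \<or> L = carrier M)"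

definition direct_summand :: "'b set \<Rightarrow> ('a, 'c) ring_scheme \<Rightarrow> ('a, 'b, 'd) module_scheme \<Rightarrow> bool"
  where "direct_summand B R M \<longleftrightarrow>
    submodule B R M \<and>
    (\<exists>C. submodule C R M \<and> B \<inter> C = {\<zero>\<^bsub>M\<^esub>} \<and> B <+>\<^bsub>M\<^esub> C = carrier M)"

definition soc :: "('a, 'c) ring_scheme \<Rightarrow> ('a, 'b, 'd) module_scheme \<Rightarrow> 'b set"
  where "soc R M =
    {(\<Oplus>\<^bsub>M\<^esub>B\<in>F. f B) | F f. finite F \<and> (\<forall>B\<in>F. simple_submodule B R M \<and> f B \<in> B)}"

definition rad :: "('a, 'c) ring_scheme \<Rightarrow> ('a, 'b, 'd) module_scheme \<Rightarrow> 'b set"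
  where "rad R M = carrier M \<inter> \<Inter> {N. maximal_submodule N R M}"

definition semisimple_rmodule :: "('a, 'c) ring_scheme \<Rightarrow> ('a, 'b, 'd) module_scheme \<Rightarrow> bool"
  where "semisimple_rmodule R M \<longleftrightarrow> soc R M = carrier M"

definition simple_direct_projective :: "('a, 'c) ring_scheme \<Rightarrow> ('a, 'b, 'd) module_scheme \<Rightarrow> bool"
  where "simple_direct_projective R M \<longleftrightarrow>
    (\<forall>A B. submodule A R M \<and> simple_submodule B R M \<and>
       rmod_isomorphic R (quot_module M A) (M\<lparr>carrier := B\<rparr>) \<and> direct_summand B R M
       \<longrightarrow> direct_summand A R M)"

definition local_ring :: "('a, 'c) ring_scheme \<Rightarrow> bool"
  where "local_ring R \<longleftrightarrow> ring R \<and> (\<exists>!I. maximal_submodule I R (right_regular R))"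

text \<open>
  A formula of HOL cannot quantify over modules on all types. The type variable \<open>'u\<close> therefore plays
  the role of a universe: projectivity, projective covers and right perfectness refer to the
  right modules whose carrier is a set of elements of \<open>'u\<close>. If \<open>'u\<close> is infinite and at least as
  large as the ring, this class is closed (up to isomorphism) under submodules, quotients and the
  free modules on carriers of its members. In particular projectivity relative to \<open>'u\<close> then
  coincides with absolute projectivity, and the projective covers of members of the class, where
  they exist, can be found inside the class.
\<close>

definition projective_rmodule :: "('a, 'c) ring_scheme \<Rightarrow> ('a, 'u) module \<Rightarrow> bool"
  where "projective_rmodule R P \<longleftrightarrow>
    right_module R P \<and>
    (\<forall>(A :: ('a, 'u) module) (B :: ('a, 'u) module) g f.
       right_module R A \<and> right_module R B \<and>
       g \<in> rmod_hom R A B \<and> g ` carrier A = carrier B \<and> f \<in> rmod_hom R P B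
       \<longrightarrow> (\<exists>h\<in>rmod_hom R P A. \<forall>x\<in>carrier P. g (h x) = f x))"

definition small_submodule :: "'b set \<Rightarrow> ('a, 'c) ring_scheme \<Rightarrow> ('a, 'b, 'd) module_scheme \<Rightarrow> bool"
  where "small_submodule K R M \<longleftrightarrow>
    submodule K R M \<and>
    (\<forall>N. submodule N R M \<and> K <+>\<^bsub>M\<^esub> N = carrier M \<longrightarrow> N = carrier M)"

definition projective_cover ::
  "('a, 'c) ring_scheme \<Rightarrow> ('a, 'u) module \<Rightarrow> ('u \<Rightarrow> 'u) \<Rightarrow> ('a, 'u) module \<Rightarrow> bool"
  where "projective_cover R P p M \<longleftrightarrow>
    projective_rmodule R P \<and> p \<in> rmod_hom R P M \<and> p ` carrier P = carrier M \<and>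
    small_submodule (a_kernel P M p) R P"

definition right_perfect :: "'u itself \<Rightarrow> ('a, 'c) ring_scheme \<Rightarrow> bool"
  where "right_perfect U R \<longleftrightarrow>
    ring R \<and>
    (\<forall>M :: ('a, 'u) module. right_module R M \<longrightarrow> (\<exists>P p. projective_cover R P p M))"

end

theory Submission
  imports Defs "HOL-Algebra.Free_Abelian_Groups"
begin

text \<open>
  Let \<open>J\<close> be the maximal right ideal of \<open>R\<close>, whose complement consists of units, so that all simple
  modules are isomorphic to \<open>R/J\<close>. If \<open>soc(M)\<close> is not contained in \<open>rad(M)\<close>, some simple submodule \<open>B\<close>
  misses a maximal submodule and is therefore a direct summand. Every maximal submodule \<open>A\<close> satisfies
  \<open>M/A \<cong> B\<close>, so simple-direct-projectivity makes \<open>A\<close> a direct summand with a simple complement; in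
  particular \<open>A\<close> cannot contain \<open>soc(M)\<close>. Perfectness enters only here: if \<open>soc(M) \<noteq> M\<close>, some maximal
  submodule contains \<open>soc(M)\<close>. Indeed \<open>soc(M) J = 0\<close>, so \<open>soc(M) + M J = M\<close> would give
  \<open>(M J) J = M J\<close>, and a module with \<open>N J = N\<close> over a right perfect local ring vanishes: its
  projective cover \<open>P\<close> satisfies \<open>P J = P\<close> as well, which forces \<open>P = 0\<close> by Nakayama's lemma
  applied to coordinates.

  Conversely, a simple direct summand \<open>B\<close> has a maximal complement, hence is not contained in
  \<open>rad(M)\<close>, and if \<open>M\<close> is semisimple then a submodule with simple quotient has a complement.
\<close>

subsection \<open>Right modules, submodules and homomorphisms\<close>

context right_module
begin

lemma ract_zero_left [simp]:
  assumes "x \<in> carrier M"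
  shows "\<zero>\<^bsub>R\<^esub> \<odot>\<^bsub>M\<^esub> x = \<zero>\<^bsub>M\<^esub>"
proof -
  have "\<zero>\<^bsub>R\<^esub> \<odot>\<^bsub>M\<^esub> x \<oplus>\<^bsub>M\<^esub> \<zero>\<^bsub>R\<^esub> \<odot>\<^bsub>M\<^esub> x = \<zero>\<^bsub>R\<^esub> \<odot>\<^bsub>M\<^esub> x"
    using ract_l_distr[of "\<zero>\<^bsub>R\<^esub>" "\<zero>\<^bsub>R\<^esub>" x] assms by simp
  then show ?thesis
    using assms ract_closed[of "\<zero>\<^bsub>R\<^esub>" x] by (simp add: M.add.l_cancel_one)
qed

lemma ract_zero_right [simp]:
  assumes "a \<in> carrier R"
  shows "a \<odot>\<^bsub>M\<^esub> \<zero>\<^bsub>M\<^esub> = \<zero>\<^bsub>M\<^esub>"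
proof -
  have "a \<odot>\<^bsub>M\<^esub> \<zero>\<^bsub>M\<^esub> \<oplus>\<^bsub>M\<^esub> a \<odot>\<^bsub>M\<^esub> \<zero>\<^bsub>M\<^esub> = a \<odot>\<^bsub>M\<^esub> \<zero>\<^bsub>M\<^esub>"
    using ract_r_distr[of a "\<zero>\<^bsub>M\<^esub>" "\<zero>\<^bsub>M\<^esub>"] assms by simp
  then show ?thesis
    using assms ract_closed[of a "\<zero>\<^bsub>M\<^esub>"] by (simp add: M.add.l_cancel_one)
qed

lemma ract_minus_left:
  assumes "a \<in> carrier R" "x \<in> carrier M"
  shows "(\<ominus>\<^bsub>R\<^esub> a) \<odot>\<^bsub>M\<^esub> x = \<ominus>\<^bsub>M\<^esub> (a \<odot>\<^bsub>M\<^esub> x)"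
proof -
  have "(\<ominus>\<^bsub>R\<^esub> a) \<odot>\<^bsub>M\<^esub> x \<oplus>\<^bsub>M\<^esub> a \<odot>\<^bsub>M\<^esub> x = \<zero>\<^bsub>M\<^esub>"
    using ract_l_distr[of "\<ominus>\<^bsub>R\<^esub> a" a x] assms by (simp add: R.l_neg)
  then show ?thesis
    using assms ract_closed by (metis M.minus_equality R.a_inv_closed)
qed

lemma ract_minus_one: "x \<in> carrier M \<Longrightarrow> (\<ominus>\<^bsub>R\<^esub> \<one>\<^bsub>R\<^esub>) \<odot>\<^bsub>M\<^esub> x = \<ominus>\<^bsub>M\<^esub> x"
  by (simp add: ract_minus_left ract_one)

text \<open>Closure under negation comes for free, since the negative of \<open>x\<close> is
  \<open>x\<close> acted on by \<open>\<ominus> \<one>\<close>. This leaves four conditions to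
  check.\<close>

lemma submodule_iff:
  "submodule N R M \<longleftrightarrow> N \<subseteq> carrier M \<and> \<zero>\<^bsub>M\<^esub> \<in> N \<and>
     (\<forall>x\<in>N. \<forall>y\<in>N. x \<oplus>\<^bsub>M\<^esub> y \<in> N) \<and> (\<forall>a\<in>carrier R. \<forall>x\<in>N. a \<odot>\<^bsub>M\<^esub> x \<in> N)"
  (is "_ \<longleftrightarrow> ?rhs")
proof
  assume "submodule N R M"
  then interpret N: submodule N R M .
  show ?rhs
    using N.subset N.one_closed N.m_closed N.smult_closed by simp
next
  assume ?rhs
  moreover from this have "\<ominus>\<^bsub>M\<^esub> x \<in> N" if "x \<in> N" for x
    using that ract_minus_one[of x, symmetric] by (simp add: subset_iff)
  ultimately show "submodule N R M"
    by (intro submodule.intro subgroup.intro submodule_axioms.intro) (auto simp: a_inv_def)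
qed

lemma submoduleI:
  assumes "N \<subseteq> carrier M" "\<zero>\<^bsub>M\<^esub> \<in> N"
    and "\<And>x y. x \<in> N \<Longrightarrow> y \<in> N \<Longrightarrow> x \<oplus>\<^bsub>M\<^esub> y \<in> N"
    and "\<And>a x. a \<in> carrier R \<Longrightarrow> x \<in> N \<Longrightarrow> a \<odot>\<^bsub>M\<^esub> x \<in> N"
  shows "submodule N R M"
  using assms by (simp add: submodule_iff)

lemma submoduleD:
  assumes "submodule N R M"
  shows "N \<subseteq> carrier M" "\<zero>\<^bsub>M\<^esub> \<in> N"
    and "x \<in> N \<Longrightarrow> y \<in> N \<Longrightarrow> x \<oplus>\<^bsub>M\<^esub> y \<in> N"
    and "a \<in> carrier R \<Longrightarrow> x \<in> N \<Longrightarrow> a \<odot>\<^bsub>M\<^esub> x \<in> N"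
  using assms by (simp_all add: submodule_iff)

lemma submodule_neg: "submodule N R M \<Longrightarrow> x \<in> N \<Longrightarrow> \<ominus>\<^bsub>M\<^esub> x \<in> N"
  using ract_minus_one[of x, symmetric] by (simp add: submodule_iff subset_iff)

lemma submodule_diff: "submodule N R M \<Longrightarrow> x \<in> N \<Longrightarrow> y \<in> N \<Longrightarrow> x \<ominus>\<^bsub>M\<^esub> y \<in> N"
  using submodule_neg[of N y] by (simp add: submodule_iff a_minus_def)

lemma submodule_carrier: "submodule (carrier M) R M"
  by (simp add: submodule_iff ract_closed)

lemma submodule_zero: "submodule {\<zero>\<^bsub>M\<^esub>} R M"
  by (simp add: submodule_iff)

lemma submodule_Int: "submodule N R M \<Longrightarrow> submodule L R M \<Longrightarrow> submodule (N \<inter> L) R M"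
  by (simp add: submodule_iff le_infI1)

lemma submodule_Inter:
  "\<S> \<noteq> {} \<Longrightarrow> (\<And>N. N \<in> \<S> \<Longrightarrow> submodule N R M) \<Longrightarrow> submodule (\<Inter>\<S>) R M"
  by (simp add: submodule_iff Inter_subset)

lemma submodule_cyclic:
  assumes "x \<in> carrier M"
  shows "submodule ((\<lambda>a. a \<odot>\<^bsub>M\<^esub> x) ` carrier R) R M"
  unfolding submodule_iff
proof (intro conjI ballI)
  show "\<zero>\<^bsub>M\<^esub> \<in> (\<lambda>a. a \<odot>\<^bsub>M\<^esub> x) ` carrier R"
    using assms by (metis R.zero_closed imageI ract_zero_left)
  show "y \<oplus>\<^bsub>M\<^esub> z \<in> (\<lambda>a. a \<odot>\<^bsub>M\<^esub> x) ` carrier R"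
    if "y \<in> (\<lambda>a. a \<odot>\<^bsub>M\<^esub> x) ` carrier R" "z \<in> (\<lambda>a. a \<odot>\<^bsub>M\<^esub> x) ` carrier R" for y z
    using that assms by (auto simp flip: ract_l_distr)
  show "b \<odot>\<^bsub>M\<^esub> y \<in> (\<lambda>a. a \<odot>\<^bsub>M\<^esub> x) ` carrier R"
    if "b \<in> carrier R" "y \<in> (\<lambda>a. a \<odot>\<^bsub>M\<^esub> x) ` carrier R" for b y
    using that assms by (auto simp flip: ract_assoc)
qed (use assms ract_closed in auto)

lemma mem_set_add_iff: "x \<in> A <+>\<^bsub>M\<^esub> B \<longleftrightarrow> (\<exists>a\<in>A. \<exists>b\<in>B. x = a \<oplus>\<^bsub>M\<^esub> b)"
  by (simp add: set_add_def')

lemma set_addI: "a \<in> A \<Longrightarrow> b \<in> B \<Longrightarrow> a \<oplus>\<^bsub>M\<^esub> b \<in> A <+>\<^bsub>M\<^esub> B"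
  by (auto simp: mem_set_add_iff)

lemma submodule_add:
  assumes "submodule N R M" "submodule L R M"
  shows "submodule (N <+>\<^bsub>M\<^esub> L) R M" "N \<subseteq> N <+>\<^bsub>M\<^esub> L" "L \<subseteq> N <+>\<^bsub>M\<^esub> L"
proof -
  note N = assms(1)[unfolded submodule_iff] and L = assms(2)[unfolded submodule_iff]
  have sub: "N \<subseteq> carrier M" "L \<subseteq> carrier M" using N L by auto
  show "N \<subseteq> N <+>\<^bsub>M\<^esub> L"
  proof
    fix x assume "x \<in> N"
    then show "x \<in> N <+>\<^bsub>M\<^esub> L" using set_addI[of x N "\<zero>\<^bsub>M\<^esub>" L] L sub by auto
  qed
  show "L \<subseteq> N <+>\<^bsub>M\<^esub> L"
  proof
    fix x assume "x \<in> L"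
    then show "x \<in> N <+>\<^bsub>M\<^esub> L" using set_addI[of "\<zero>\<^bsub>M\<^esub>" N x L] N sub by auto
  qed
  show "submodule (N <+>\<^bsub>M\<^esub> L) R M"
    unfolding submodule_iff
  proof (intro conjI ballI)
    show "N <+>\<^bsub>M\<^esub> L \<subseteq> carrier M"
      using sub M.a_closed by (fastforce simp: mem_set_add_iff)
    show "\<zero>\<^bsub>M\<^esub> \<in> N <+>\<^bsub>M\<^esub> L" using N L set_addI[of "\<zero>\<^bsub>M\<^esub>" N "\<zero>\<^bsub>M\<^esub>" L] by simp
  next
    fix x y assume "x \<in> N <+>\<^bsub>M\<^esub> L" "y \<in> N <+>\<^bsub>M\<^esub> L"
    then obtain n l n' l' where xy: "n \<in> N" "l \<in> L" "n' \<in> N" "l' \<in> L"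
      "x = n \<oplus>\<^bsub>M\<^esub> l" "y = n' \<oplus>\<^bsub>M\<^esub> l'" unfolding mem_set_add_iff by blast
    have "n \<in> carrier M" "l \<in> carrier M" "n' \<in> carrier M" "l' \<in> carrier M" using xy sub by auto
    then have "x \<oplus>\<^bsub>M\<^esub> y = (n \<oplus>\<^bsub>M\<^esub> n') \<oplus>\<^bsub>M\<^esub> (l \<oplus>\<^bsub>M\<^esub> l')"
      using xy by (simp add: M.a_ac)
    then show "x \<oplus>\<^bsub>M\<^esub> y \<in> N <+>\<^bsub>M\<^esub> L"
      using xy N L set_addI[of "n \<oplus>\<^bsub>M\<^esub> n'" N "l \<oplus>\<^bsub>M\<^esub> l'" L] by simp
  next
    fix a x assume a: "a \<in> carrier R" "x \<in> N <+>\<^bsub>M\<^esub> L"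
    then obtain n l where xy: "n \<in> N" "l \<in> L" "x = n \<oplus>\<^bsub>M\<^esub> l" unfolding mem_set_add_iff by blast
    then have "a \<odot>\<^bsub>M\<^esub> x = a \<odot>\<^bsub>M\<^esub> n \<oplus>\<^bsub>M\<^esub> a \<odot>\<^bsub>M\<^esub> l"
      using a sub ract_r_distr by blast
    then show "a \<odot>\<^bsub>M\<^esub> x \<in> N <+>\<^bsub>M\<^esub> L"
      using xy a N L set_addI by simp
  qed
qed

text \<open>Two elements of the union lie in a common member of the chain. This supplies the upper
  bounds for Zorn's lemma.\<close>

lemma submodule_UN_chain:
  assumes "\<C> \<noteq> {}" "subset.chain {N. submodule N R M} \<C>"
  shows "submodule (\<Union>\<C>) R M"
proof -
  have sub: "\<And>N. N \<in> \<C> \<Longrightarrow> submodule N R M"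
    and comp: "\<And>N L. N \<in> \<C> \<Longrightarrow> L \<in> \<C> \<Longrightarrow> N \<subseteq> L \<or> L \<subseteq> N"
    using assms(2) unfolding subset.chain_def by auto
  have "x \<oplus>\<^bsub>M\<^esub> y \<in> \<Union>\<C>" if "x \<in> \<Union>\<C>" "y \<in> \<Union>\<C>" for x y
  proof -
    from that obtain N L where "N \<in> \<C>" "x \<in> N" "L \<in> \<C>" "y \<in> L" by blast
    with comp[of N L] obtain N where "N \<in> \<C>" "x \<in> N" "y \<in> N" by blast
    then show ?thesis using submoduleD(3)[OF sub] by blast
  qed
  moreover have "N \<subseteq> carrier M" "\<zero>\<^bsub>M\<^esub> \<in> N" "\<And>a x. a \<in> carrier R \<Longrightarrow> x \<in> N \<Longrightarrow> a \<odot>\<^bsub>M\<^esub> x \<in> N"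
    if "N \<in> \<C>" for N
    using sub[OF that] by (auto simp: submodule_iff)
  ultimately show ?thesis
    using assms(1) by (intro submoduleI) (blast, blast, blast, blast)
qed

text \<open>Zorn's lemma. Missing the fixed element \<open>x\<close> passes to unions of chains,
  whereas being a proper submodule need not.\<close>

lemma exists_maximal_avoiding:
  assumes A: "submodule A R M" "x \<notin> A"
  obtains N where "submodule N R M" "A \<subseteq> N" "x \<notin> N"
    "\<And>L. submodule L R M \<Longrightarrow> N \<subseteq> L \<Longrightarrow> x \<notin> L \<Longrightarrow> L = N"
proof -
  let ?S = "{N. submodule N R M \<and> A \<subseteq> N \<and> x \<notin> N}"
  have "\<exists>N\<in>?S. \<forall>L\<in>?S. N \<subseteq> L \<longrightarrow> L = N"
  proof (rule subset_Zorn_nonempty)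
    show "?S \<noteq> {}" using A by auto
    fix \<C> assume C: "\<C> \<noteq> {}" "subset.chain ?S \<C>"
    have "subset.chain {N. submodule N R M} \<C>"
      using C(2) unfolding subset.chain_def by blast
    from submodule_UN_chain[OF C(1) this]
    show "\<Union>\<C> \<in> ?S"
      using C unfolding subset.chain_def by blast
  qed
  then obtain N where N: "N \<in> ?S" "\<forall>L\<in>?S. N \<subseteq> L \<longrightarrow> L = N" by (rule bexE)
  show ?thesis
  proof (rule that[of N])
    fix L assume "submodule L R M" "N \<subseteq> L" "x \<notin> L"
    with N(1) have "L \<in> ?S" by auto
    then show "L = N" using N(2) \<open>N \<subseteq> L\<close> by simp
  qed (use N(1) in auto)
qed

lemma right_module_restrict:
  assumes "submodule N R M"
  shows "right_module R (M\<lparr>carrier := N\<rparr>)"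
proof -
  note N = assms[unfolded submodule_iff]
  have sub: "\<And>x. x \<in> N \<Longrightarrow> x \<in> carrier M" using N by blast
  have "abelian_group (M\<lparr>carrier := N\<rparr>)"
  proof (rule abelian_groupI)
    fix x assume "x \<in> carrier (M\<lparr>carrier := N\<rparr>)"
    then show "\<exists>y\<in>carrier (M\<lparr>carrier := N\<rparr>).
        y \<oplus>\<^bsub>M\<lparr>carrier := N\<rparr>\<^esub> x = \<zero>\<^bsub>M\<lparr>carrier := N\<rparr>\<^esub>"
      using submodule_neg[OF assms, of x] sub
      by (auto intro!: bexI[of _ "\<ominus>\<^bsub>M\<^esub> x"] M.l_neg)
  qed (use N sub in \<open>auto simp: M.a_ac\<close>)
  then show ?thesis
    using N
    by (intro right_module.intro right_module_axioms.intro)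
      (auto simp: sub ract_l_distr ract_r_distr ract_assoc ract_one R.ring_axioms)
qed

lemma submodule_restrict_iff:
  assumes "submodule N R M"
  shows "submodule L R (M\<lparr>carrier := N\<rparr>) \<longleftrightarrow> submodule L R M \<and> L \<subseteq> N"
proof -
  interpret N: right_module R "M\<lparr>carrier := N\<rparr>"
    by (rule right_module_restrict[OF assms])
  show ?thesis
    using assms unfolding N.submodule_iff submodule_iff by auto
qed

lemma finsum_in_submodule:
  assumes "submodule N R M" "finite A" "\<And>i. i \<in> A \<Longrightarrow> f i \<in> N"
  shows "finsum M f A \<in> N"
  using assms(2,3)
proof (induction rule: finite_induct)
  case empty
  then show ?case using assms(1) by (simp add: submodule_iff)
next
  case (insert i A)
  then have "f \<in> A \<rightarrow> carrier M" "f i \<in> carrier M"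
    using assms(1) by (auto simp: submodule_iff)
  then show ?case
    using insert assms(1) by (simp add: M.finsum_insert submodule_iff)
qed

section \<open>Simple and maximal submodules\<close>

lemma simple_submodule_iff:
  "simple_submodule B R M \<longleftrightarrow> submodule B R M \<and> B \<noteq> {\<zero>\<^bsub>M\<^esub>} \<and>
     (\<forall>N. submodule N R M \<and> N \<subseteq> B \<longrightarrow> N = {\<zero>\<^bsub>M\<^esub>} \<or> N = B)"
proof (cases "submodule B R M")
  case True
  then show ?thesis
    unfolding simple_submodule_def simple_rmodule_def
    by (simp add: submodule_restrict_iff right_module_restrict)
qed (simp add: simple_submodule_def)

lemma simple_submoduleD:
  assumes "simple_submodule B R M"
  shows "submodule B R M" "x \<in> B \<Longrightarrow> x \<in> carrier M" "\<zero>\<^bsub>M\<^esub> \<in> B"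
    and "x \<in> B \<Longrightarrow> y \<in> B \<Longrightarrow> x \<oplus>\<^bsub>M\<^esub> y \<in> B"
    and "a \<in> carrier R \<Longrightarrow> x \<in> B \<Longrightarrow> a \<odot>\<^bsub>M\<^esub> x \<in> B"
  using assms by (simp_all add: simple_submodule_iff submodule_iff subset_iff)

text \<open>The cyclic submodule generated by \<open>x\<close> contains \<open>x\<close>, so it is a
  nonzero submodule of \<open>B\<close>.\<close>

lemma simple_submodule_cyclic:
  assumes "simple_submodule B R M" "x \<in> B" "x \<noteq> \<zero>\<^bsub>M\<^esub>" "y \<in> B"
  obtains a where "a \<in> carrier R" "y = a \<odot>\<^bsub>M\<^esub> x"
proof -
  have B: "submodule B R M" and x: "x \<in> carrier M"
    using assms unfolding simple_submodule_iff submodule_iff by auto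
  let ?C = "(\<lambda>a. a \<odot>\<^bsub>M\<^esub> x) ` carrier R"
  have "x \<in> ?C" using x ract_one by (metis R.one_closed imageI)
  moreover have "?C \<subseteq> B" using B assms(2) by (auto simp: submodule_iff)
  ultimately have "?C = B"
    using assms(1,3) submodule_cyclic[OF x] unfolding simple_submodule_iff by blast
  then show ?thesis using assms(4) that by blast
qed

lemma simple_submodule_Int:
  assumes "simple_submodule B R M" "submodule N R M" "\<not> B \<subseteq> N"
  shows "B \<inter> N = {\<zero>\<^bsub>M\<^esub>}"
  using assms submodule_Int[of B N] unfolding simple_submodule_iff by blast

lemma maximal_submodule_add:
  assumes "maximal_submodule N R M" "submodule L R M" "\<not> L \<subseteq> N"
  shows "N <+>\<^bsub>M\<^esub> L = carrier M"
  using assms submodule_add[of N L] unfolding maximal_submodule_def by blast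

text \<open>The cyclic submodule of \<open>x\<close> is not inside \<open>N\<close>, so by
  maximality its sum with \<open>N\<close> is everything.\<close>

lemma maximal_submodule_decompose:
  assumes "maximal_submodule N R M" "x \<in> carrier M" "x \<notin> N" "y \<in> carrier M"
  obtains n a where "n \<in> N" "a \<in> carrier R" "y = n \<oplus>\<^bsub>M\<^esub> a \<odot>\<^bsub>M\<^esub> x"
proof -
  let ?C = "(\<lambda>a. a \<odot>\<^bsub>M\<^esub> x) ` carrier R"
  have "x \<in> ?C" using assms(2) ract_one by (metis R.one_closed imageI)
  then have "N <+>\<^bsub>M\<^esub> ?C = carrier M"
    using maximal_submodule_add[OF assms(1) submodule_cyclic] assms(2,3) by blast
  then have "y \<in> N <+>\<^bsub>M\<^esub> ?C" using assms(4) by simp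
  then show ?thesis using that unfolding mem_set_add_iff by blast
qed

section \<open>The socle\<close>

lemma mem_socE:
  assumes "x \<in> soc R M"
  obtains F f where "finite F" "\<forall>B\<in>F. simple_submodule B R M" "\<forall>B\<in>F. f B \<in> B" "x = finsum M f F"
  using assms unfolding soc_def by auto

lemma mem_socI:
  assumes "finite F" "\<And>B. B \<in> F \<Longrightarrow> simple_submodule B R M" "\<And>B. B \<in> F \<Longrightarrow> f B \<in> B"
  shows "finsum M f F \<in> soc R M"
  unfolding soc_def using assms by (intro CollectI exI[of _ F] exI[of _ f]) simp

lemma simple_subset_soc:
  assumes "simple_submodule B R M"
  shows "B \<subseteq> soc R M"
proof
  fix x assume x: "x \<in> B"
  then have "x \<in> carrier M" using assms by (rule simple_submoduleD(2)[rotated])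
  then show "x \<in> soc R M"
    using mem_socI[of "{B}" "\<lambda>_. x"] x assms by simp
qed

text \<open>With \<open>simple_subset_soc\<close> and \<open>submodule_soc\<close> this makes the
  socle the least submodule above all simple ones, and later arguments need not return to finite
  sums.\<close>

lemma soc_least:
  assumes "submodule N R M" "\<And>B. simple_submodule B R M \<Longrightarrow> B \<subseteq> N"
  shows "soc R M \<subseteq> N"
proof
  fix x assume "x \<in> soc R M"
  then obtain F f where F: "finite F" "\<forall>B\<in>F. simple_submodule B R M" "\<forall>B\<in>F. f B \<in> B"
    "x = finsum M f F"
    by (rule mem_socE)
  show "x \<in> N"
    unfolding F(4) by (rule finsum_in_submodule[OF assms(1) F(1)]) (use F(2,3) assms(2) in blast)
qed

lemma soc_subset_carrier: "soc R M \<subseteq> carrier M"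
  by (rule soc_least[OF submodule_carrier]) (simp add: simple_submodule_iff submodule_iff)

end

text \<open>Brings finite sums with different index sets to a common one, so that elements of the
  socle can be added termwise.\<close>

lemma finsum_zero_extend:
  assumes "abelian_monoid G" "finite H" "F \<subseteq> H" "\<And>i. i \<in> F \<Longrightarrow> f i \<in> carrier G"
  shows "finsum G f F = finsum G (\<lambda>i. if i \<in> F then f i else \<zero>\<^bsub>G\<^esub>) H"
proof -
  interpret abelian_monoid G by fact
  show ?thesis
    by (rule add.finprod_mono_neutral_cong_left) (use assms in auto)
qed

context right_module
begin

lemma finsum_ract:
  assumes "finite A" "a \<in> carrier R" "f \<in> A \<rightarrow> carrier M"
  shows "a \<odot>\<^bsub>M\<^esub> finsum M f A = finsum M (\<lambda>i. a \<odot>\<^bsub>M\<^esub> f i) A"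
  using assms(1,3)
proof (induction rule: finite_induct)
  case (insert i A)
  then have "f \<in> A \<rightarrow> carrier M" "f i \<in> carrier M" by auto
  moreover from this have "(\<lambda>i. a \<odot>\<^bsub>M\<^esub> f i) \<in> A \<rightarrow> carrier M" "a \<odot>\<^bsub>M\<^esub> f i \<in> carrier M"
    using assms(2) ract_closed by auto
  ultimately show ?case
    using insert assms(2) by (simp add: M.finsum_insert ract_r_distr)
qed (use assms in simp)

lemma submodule_soc: "submodule (soc R M) R M"
  unfolding submodule_iff
proof (intro conjI ballI)
  show "soc R M \<subseteq> carrier M" by (rule soc_subset_carrier)
  show "\<zero>\<^bsub>M\<^esub> \<in> soc R M"
    using mem_socI[of "{}"] by simp
next
  fix x y assume "x \<in> soc R M" "y \<in> soc R M"
  obtain F f where F: "finite F" "\<forall>B\<in>F. simple_submodule B R M" "\<forall>B\<in>F. f B \<in> B"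
    "x = finsum M f F"
    using \<open>x \<in> soc R M\<close> by (rule mem_socE)
  obtain G g where G: "finite G" "\<forall>B\<in>G. simple_submodule B R M" "\<forall>B\<in>G. g B \<in> B"
    "y = finsum M g G"
    using \<open>y \<in> soc R M\<close> by (rule mem_socE)
  \<comment> \<open>Sums in the socle are indexed by the simple submodules themselves, with one
    summand for each. Padding by zero on \<open>F \<union> G\<close> merges the two summands of a
    submodule that occurs in both sums.\<close>
  let ?f = "\<lambda>B. if B \<in> F then f B else \<zero>\<^bsub>M\<^esub>" and ?g = "\<lambda>B. if B \<in> G then g B else \<zero>\<^bsub>M\<^esub>"
  have fc: "f B \<in> carrier M" if "B \<in> F" for B
    using F(2,3) that simple_submoduleD(2)[of B "f B"] by simp
  have gc: "g B \<in> carrier M" if "B \<in> G" for B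
    using G(2,3) that simple_submoduleD(2)[of B "g B"] by simp
  have fin: "finite (F \<union> G)" using F(1) G(1) by simp
  have "x = finsum M ?f (F \<union> G)"
    unfolding F(4) by (rule finsum_zero_extend[OF M.abelian_monoid_axioms fin _ fc]) auto
  moreover have "y = finsum M ?g (F \<union> G)"
    unfolding G(4) by (rule finsum_zero_extend[OF M.abelian_monoid_axioms fin _ gc]) auto
  moreover have "finsum M (\<lambda>B. ?f B \<oplus>\<^bsub>M\<^esub> ?g B) (F \<union> G) = finsum M ?f (F \<union> G) \<oplus>\<^bsub>M\<^esub> finsum M ?g (F \<union> G)"
    by (rule M.finsum_addf) (use fc gc in auto)
  moreover have "?f B \<oplus>\<^bsub>M\<^esub> ?g B \<in> B" if "B \<in> F \<union> G" for B
  proof -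
    have B: "simple_submodule B R M" using F(2) G(2) that by blast
    have "?f B \<in> B" "?g B \<in> B" using F(3) G(3) simple_submoduleD(3)[OF B] by simp_all
    then show ?thesis using B simple_submoduleD(4)[OF B] by simp
  qed
  ultimately show "x \<oplus>\<^bsub>M\<^esub> y \<in> soc R M"
    using mem_socI[of "F \<union> G" "\<lambda>B. ?f B \<oplus>\<^bsub>M\<^esub> ?g B"] F(1,2) G(1,2) by auto
next
  fix a x assume a: "a \<in> carrier R" "x \<in> soc R M"
  obtain F f where F: "finite F" "\<forall>B\<in>F. simple_submodule B R M" "\<forall>B\<in>F. f B \<in> B"
    "x = finsum M f F"
    using a(2) by (rule mem_socE)
  have fB: "f B \<in> carrier M" "a \<odot>\<^bsub>M\<^esub> f B \<in> B" if "B \<in> F" for B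
    using F(2,3) that a(1) simple_submoduleD(2)[of B "f B"] simple_submoduleD(5)[of B a "f B"] by simp_all
  have "a \<odot>\<^bsub>M\<^esub> x = finsum M (\<lambda>B. a \<odot>\<^bsub>M\<^esub> f B) F"
    unfolding F(4) by (rule finsum_ract) (use F(1) a(1) fB in auto)
  then show "a \<odot>\<^bsub>M\<^esub> x \<in> soc R M"
    using mem_socI[of F "\<lambda>B. a \<odot>\<^bsub>M\<^esub> f B"] F(1,2) fB(2) by simp
qed

end

section \<open>The right regular module and homomorphisms\<close>

lemma right_module_right_regular:
  assumes "ring R"
  shows "right_module R (right_regular R)"
proof -
  interpret ring R by fact
  have "abelian_group (right_regular R)"
    by (rule abelian_groupI) (auto simp: right_regular_def a_ac intro: l_neg)
  then show ?thesis
    by (intro right_module.intro right_module_axioms.intro)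
      (auto simp: right_regular_def l_distr r_distr m_assoc ring_axioms)
qed

lemma finsum_right_regular: "finsum (right_regular R) = finsum R"
  by (simp add: finsum_def finprod_def right_regular_def fun_eq_iff)

lemma rmod_homI:
  assumes "\<And>x. x \<in> carrier M \<Longrightarrow> h x \<in> carrier N"
    and "\<And>x y. x \<in> carrier M \<Longrightarrow> y \<in> carrier M \<Longrightarrow> h (x \<oplus>\<^bsub>M\<^esub> y) = h x \<oplus>\<^bsub>N\<^esub> h y"
    and "\<And>a x. a \<in> carrier R \<Longrightarrow> x \<in> carrier M \<Longrightarrow> h (a \<odot>\<^bsub>M\<^esub> x) = a \<odot>\<^bsub>N\<^esub> h x"
  shows "h \<in> rmod_hom R M N"
  using assms by (auto simp: rmod_hom_def hom_def)

lemma rmod_homD: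
  assumes "h \<in> rmod_hom R M N"
  shows "x \<in> carrier M \<Longrightarrow> h x \<in> carrier N"
    and "x \<in> carrier M \<Longrightarrow> y \<in> carrier M \<Longrightarrow> h (x \<oplus>\<^bsub>M\<^esub> y) = h x \<oplus>\<^bsub>N\<^esub> h y"
    and "a \<in> carrier R \<Longrightarrow> x \<in> carrier M \<Longrightarrow> h (a \<odot>\<^bsub>M\<^esub> x) = a \<odot>\<^bsub>N\<^esub> h x"
  using assms by (auto simp: rmod_hom_def hom_def)

lemma rmod_hom_comp:
  assumes "g \<in> rmod_hom R M N" "h \<in> rmod_hom R N P"
  shows "h \<circ> g \<in> rmod_hom R M P"
  by (rule rmod_homI) (auto simp: rmod_homD[OF assms(1)] rmod_homD[OF assms(2)])

lemma rmod_hom_inv_into: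
  assumes "right_module R M" "h \<in> rmod_hom R M N" "bij_betw h (carrier M) (carrier N)"
  shows "inv_into (carrier M) h \<in> rmod_hom R N M"
proof -
  interpret M: right_module R M by fact
  have inj: "inj_on h (carrier M)" and im: "carrier N = h ` carrier M"
    using assms(3) by (auto simp: bij_betw_def)
  show ?thesis
    by (rule rmod_homI)
      (auto simp: im inj M.ract_closed simp flip: rmod_homD(2,3)[OF assms(2)])
qed

locale rmod_homomorphism = M: right_module R M + N: right_module R N
  for R :: "('a, 'c) ring_scheme" and M :: "('a, 'b, 'd) module_scheme"
    and N :: "('a, 'e, 'f) module_scheme" +
  fixes h
  assumes hom: "h \<in> rmod_hom R M N"
begin

lemmas hom_closed = rmod_homD(1)[OF hom]
  and hom_add = rmod_homD(2)[OF hom]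
  and hom_ract = rmod_homD(3)[OF hom]

lemma hom_zero: "h \<zero>\<^bsub>M\<^esub> = \<zero>\<^bsub>N\<^esub>"
  by (metis M.M.zero_closed M.R.zero_closed M.ract_zero_left N.ract_zero_left hom_closed hom_ract)

lemma submodule_vimage:
  assumes "submodule L R N"
  shows "submodule {x \<in> carrier M. h x \<in> L} R M"
  using assms unfolding M.submodule_iff N.submodule_iff
  by (auto simp: hom_zero hom_add hom_ract M.ract_closed)

lemma submodule_image:
  assumes "submodule L R M"
  shows "submodule (h ` L) R N"
  unfolding N.submodule_iff
proof (intro conjI ballI)
  note L = assms[unfolded M.submodule_iff]
  show "h ` L \<subseteq> carrier N" using L hom_closed by blast
  show "\<zero>\<^bsub>N\<^esub> \<in> h ` L" using L hom_zero by (metis imageI)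
  show "x \<oplus>\<^bsub>N\<^esub> y \<in> h ` L" if "x \<in> h ` L" "y \<in> h ` L" for x y
    using that L by (auto simp: subset_iff simp flip: hom_add)
  show "a \<odot>\<^bsub>N\<^esub> x \<in> h ` L" if "a \<in> carrier R" "x \<in> h ` L" for a x
    using that L by (auto simp: subset_iff simp flip: hom_ract)
qed

lemma hom_finsum:
  assumes "finite A" "f \<in> A \<rightarrow> carrier M"
  shows "h (finsum M f A) = finsum N (\<lambda>i. h (f i)) A"
  using assms
proof (induction rule: finite_induct)
  case (insert i A)
  then have "f \<in> A \<rightarrow> carrier M" "f i \<in> carrier M" by auto
  moreover from this have "(\<lambda>i. h (f i)) \<in> A \<rightarrow> carrier N" "h (f i) \<in> carrier N"
    using hom_closed by auto
  ultimately show ?case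
    using insert by (simp add: M.M.finsum_insert N.M.finsum_insert hom_add)
qed (simp add: hom_zero)

end

subsection \<open>Local rings\<close>

text \<open>Turns the unique existence in \<open>local_ring\<close> into a named right ideal. Being
  the only maximal right ideal, \<open>J\<close> is the Jacobson radical of
  \<open>R\<close>.\<close>

locale local_ring_radical = ring R for R :: "('a, 'c) ring_scheme" (structure) +
  fixes J
  assumes maximal_J: "maximal_submodule J R (right_regular R)"
    and unique_J: "maximal_submodule I R (right_regular R) \<Longrightarrow> I = J"
begin

lemma right_module_regular: "right_module R (right_regular R)"
  by (rule right_module_right_regular[OF ring_axioms])

lemma J_right_ideal:
  shows "j \<in> J \<Longrightarrow> j \<in> carrier R" "\<zero> \<in> J"
    and "i \<in> J \<Longrightarrow> j \<in> J \<Longrightarrow> i \<oplus> j \<in> J"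
    and "j \<in> J \<Longrightarrow> a \<in> carrier R \<Longrightarrow> j \<otimes> a \<in> J"
proof -
  have J: "submodule J R (right_regular R)"
    using maximal_J by (simp add: maximal_submodule_def)
  note D = right_module.submoduleD[OF right_module_regular J, unfolded right_regular_def, simplified]
  show "j \<in> J \<Longrightarrow> j \<in> carrier R" "\<zero> \<in> J" "i \<in> J \<Longrightarrow> j \<in> J \<Longrightarrow> i \<oplus> j \<in> J"
    using D(1,2,3) by auto
  show "j \<in> J \<Longrightarrow> a \<in> carrier R \<Longrightarrow> j \<otimes> a \<in> J"
    using D(4) by simp
qed

lemma one_notin_J: "\<one> \<notin> J"
proof
  assume "\<one> \<in> J"
  then have "carrier R \<subseteq> J" using J_right_ideal(4)[of \<one>] by auto
  then show False
    using maximal_J J_right_ideal(1) by (auto simp: maximal_submodule_def right_regular_def)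
qed

text \<open>If the right ideal generated by \<open>x\<close> missed \<open>\<one>\<close>, a right
  ideal above it and maximal among those missing \<open>\<one>\<close> would have to be
  \<open>J\<close>, and \<open>x\<close> would lie in \<open>J\<close>.\<close>

lemma right_inverse_notin_J:
  assumes "x \<in> carrier R" "x \<notin> J"
  obtains y where "y \<in> carrier R" "x \<otimes> y = \<one>"
proof -
  interpret reg: right_module R "right_regular R" by (rule right_module_regular)
  let ?C = "(\<lambda>a. x \<otimes> a) ` carrier R"
  have C: "submodule ?C R (right_regular R)"
    using reg.submodule_cyclic[of x] assms(1) by (simp add: right_regular_def)
  have "\<one> \<in> ?C"
  proof (rule ccontr)
    assume "\<one> \<notin> ?C"
    then obtain N where N: "submodule N R (right_regular R)" "?C \<subseteq> N" "\<one> \<notin> N"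
      "\<And>L. submodule L R (right_regular R) \<Longrightarrow> N \<subseteq> L \<Longrightarrow> \<one> \<notin> L \<Longrightarrow> L = N"
      using reg.exists_maximal_avoiding[OF C] by metis
    \<comment> \<open>A right ideal with \<open>\<one>\<close> is the whole ring, so maximality
      among those missing \<open>\<one>\<close> is plain maximality.\<close>
    have "L = carrier (right_regular R)" if "submodule L R (right_regular R)" "\<one> \<in> L" for L
    proof -
      note D = reg.submoduleD[OF that(1), unfolded right_regular_def, simplified]
      have "a \<in> L" if "a \<in> carrier R" for a
        using D(4)[OF that \<open>\<one> \<in> L\<close>] that by simp
      then show ?thesis using D(1) by (auto simp: right_regular_def)
    qed
    then have "maximal_submodule N R (right_regular R)"
      using N unfolding maximal_submodule_def by (auto simp: right_regular_def)
    then have "N = J" by (rule unique_J)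
    moreover have "x \<otimes> \<one> \<in> N" using N(2) by blast
    ultimately have "x \<in> J" using assms(1) by simp
    then show False using assms(2) by simp
  qed
  then show ?thesis using that by auto
qed

text \<open>The right inverse \<open>y\<close> of \<open>x\<close> lies outside \<open>J\<close> as
  well, so it has a right inverse \<open>z\<close> of its own. Then \<open>x = z\<close>, and
  \<open>y\<close> is a two-sided inverse.\<close>

lemma unit_notin_J:
  assumes x: "x \<in> carrier R" "x \<notin> J"
  shows "x \<in> Units R"
proof -
  obtain y where y: "y \<in> carrier R" "x \<otimes> y = \<one>" using x by (rule right_inverse_notin_J)
  have "y \<notin> J"
  proof
    \<comment> \<open>Then \<open>\<one> \<ominus> y \<otimes> x\<close> is outside \<open>J\<close>
      and right invertible. But \<open>x\<close> times it is
      \<open>x \<ominus> (x \<otimes> y) \<otimes> x = \<zero>\<close>, which forces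
      \<open>x = \<zero>\<close>, an element of \<open>J\<close>.\<close>
    assume "y \<in> J"
    then have yx: "y \<otimes> x \<in> J" using x J_right_ideal(4) by simp
    have "\<one> \<ominus> y \<otimes> x \<notin> J"
    proof
      assume "\<one> \<ominus> y \<otimes> x \<in> J"
      then have "\<one> \<ominus> y \<otimes> x \<oplus> y \<otimes> x \<in> J" using yx J_right_ideal(3) by blast
      moreover have "\<one> \<ominus> y \<otimes> x \<oplus> y \<otimes> x = \<one>"
        using x y by (simp add: minus_eq a_assoc l_neg)
      ultimately show False using one_notin_J by simp
    qed
    then obtain z where z: "z \<in> carrier R" "(\<one> \<ominus> y \<otimes> x) \<otimes> z = \<one>"
      using right_inverse_notin_J[of "\<one> \<ominus> y \<otimes> x"] x y by auto
    have "x \<otimes> (\<one> \<ominus> y \<otimes> x) = x \<ominus> (x \<otimes> y) \<otimes> x"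
      using x y(1) by (simp add: minus_eq r_distr r_minus m_assoc)
    also have "\<dots> = \<zero>" using x y by (simp add: minus_eq r_neg)
    finally have "\<zero> = x \<otimes> ((\<one> \<ominus> y \<otimes> x) \<otimes> z)"
      using x y z(1) by (simp flip: m_assoc)
    then show False using z x J_right_ideal(2) by simp
  qed
  then obtain z where z: "z \<in> carrier R" "y \<otimes> z = \<one>" using y right_inverse_notin_J by blast
  then have "x = z" using inv_unique[of x y z] x y by simp
  then show ?thesis using x y z unfolding Units_def by blast
qed

text \<open>If \<open>a \<otimes> j\<close> were a unit, \<open>j\<close> would have a left inverse
  \<open>?b\<close>. It cannot lie in \<open>J\<close>, as \<open>?b \<otimes> j = \<one>\<close>;
  so it is a unit with inverse \<open>j\<close>, and \<open>\<one> = j \<otimes> ?b\<close> lies in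
  \<open>J\<close> after all.\<close>

lemma J_left_ideal:
  assumes "a \<in> carrier R" "j \<in> J"
  shows "a \<otimes> j \<in> J"
proof (rule ccontr)
  assume "a \<otimes> j \<notin> J"
  note j = J_right_ideal(1)[OF assms(2)]
  then have u: "a \<otimes> j \<in> Units R" using unit_notin_J \<open>a \<otimes> j \<notin> J\<close> assms by simp
  let ?b = "inv (a \<otimes> j) \<otimes> a"
  have b: "?b \<in> carrier R" "?b \<otimes> j = \<one>"
    using u assms j by (simp_all add: m_assoc)
  have "?b \<notin> J"
  proof
    assume "?b \<in> J"
    then have "?b \<otimes> j \<in> J" using J_right_ideal(4) j by blast
    then show False using b(2) one_notin_J by simp
  qed
  then have "?b \<in> Units R" using unit_notin_J b(1) by blast
  then have "j = inv ?b" using b j by (metis Units_inv_closed inv_unique Units_l_inv Units_r_inv)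
  then have "j \<otimes> ?b = \<one>" using Units_l_inv[OF \<open>?b \<in> Units R\<close>] by metis
  moreover have "j \<otimes> ?b \<in> J" using J_right_ideal(4)[OF assms(2) b(1)] .
  ultimately show False using one_notin_J by simp
qed

lemma one_minus_J_unit:
  assumes "j \<in> J"
  shows "\<one> \<ominus> j \<in> Units R"
proof (rule unit_notin_J)
  note j = J_right_ideal(1)[OF assms]
  then show "\<one> \<ominus> j \<in> carrier R" by simp
  show "\<one> \<ominus> j \<notin> J"
  proof
    assume "\<one> \<ominus> j \<in> J"
    then have "\<one> \<ominus> j \<oplus> j \<in> J" using assms J_right_ideal(3) by blast
    then show False using one_notin_J j by (simp add: minus_eq a_assoc l_neg)
  qed
qed

text \<open>Nakayama's lemma for the left ideal generated by the \<open>r v\<close>.\<close>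

lemma nakayama:
  assumes "finite S" "\<And>v. v \<in> S \<Longrightarrow> r v \<in> carrier R"
    and "\<And>v u. v \<in> S \<Longrightarrow> u \<in> S \<Longrightarrow> c v u \<in> J"
    and "\<And>v. v \<in> S \<Longrightarrow> r v = (\<Oplus>u\<in>S. c v u \<otimes> r u)"
    and "v \<in> S"
  shows "r v = \<zero>"
  using assms
proof (induction S arbitrary: c v rule: finite_induct)
  case empty
  then show ?case by blast
next
  case (insert w S)
  have rc: "r u \<in> carrier R" if "u \<in> insert w S" for u using insert.prems(1) that by blast
  have cJ: "c v u \<in> J" if "v \<in> insert w S" "u \<in> insert w S" for v u
    using insert.prems(2) that by blast
  have cc: "c v u \<in> carrier R" if "v \<in> insert w S" "u \<in> insert w S" for v u
    using cJ[OF that] J_right_ideal(1) by blast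
  have split: "r v = c v w \<otimes> r w \<oplus> (\<Oplus>u\<in>S. c v u \<otimes> r u)" if "v \<in> insert w S" for v
    using insert.prems(3)[OF that] insert.hyps rc cc that by (simp add: Pi_def)
  have u: "\<one> \<ominus> c w w \<in> Units R" using one_minus_J_unit cJ by blast
  let ?e = "inv (\<one> \<ominus> c w w)"
  have e: "?e \<in> carrier R" using u by simp
  \<comment> \<open>Elimination: the equation for \<open>w\<close> can be solved for
    \<open>r w\<close> because \<open>\<one> \<ominus> c w w\<close> is a unit.\<close>
  have rw: "r w = (\<Oplus>u\<in>S. (?e \<otimes> c w u) \<otimes> r u)"
  proof -
    have sc: "(\<Oplus>u\<in>S. c w u \<otimes> r u) \<in> carrier R" using rc cc by (intro finsum_closed) auto
    have "(\<one> \<ominus> c w w) \<otimes> r w = r w \<ominus> c w w \<otimes> r w"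
      using rc cc by (simp add: minus_eq l_distr l_minus)
    also have "\<dots> = (c w w \<otimes> r w \<oplus> (\<Oplus>u\<in>S. c w u \<otimes> r u)) \<ominus> c w w \<otimes> r w"
      using split[of w] by simp
    also have "\<dots> = (\<Oplus>u\<in>S. c w u \<otimes> r u)"
      using rc cc sc by (simp add: minus_eq a_ac r_neg1 r_neg2 r_neg l_neg)
    finally have "?e \<otimes> ((\<one> \<ominus> c w w) \<otimes> r w) = ?e \<otimes> (\<Oplus>u\<in>S. c w u \<otimes> r u)" by simp
    moreover have "?e \<otimes> ((\<one> \<ominus> c w w) \<otimes> r w) = r w"
      using u e rc[of w] cc[of w w] by (simp flip: m_assoc)
    moreover have "?e \<otimes> (\<Oplus>u\<in>S. c w u \<otimes> r u) = (\<Oplus>u\<in>S. ?e \<otimes> (c w u \<otimes> r u))"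
      using insert.hyps(1) e rc cc by (intro finsum_rdistr) auto
    moreover have "\<dots> = (\<Oplus>u\<in>S. (?e \<otimes> c w u) \<otimes> r u)"
      using e rc cc by (intro finsum_cong') (auto simp: m_assoc)
    ultimately show ?thesis by simp
  qed
  \<comment> \<open>The coefficients after substituting for \<open>r w\<close> in the other
    equations. They stay in \<open>J\<close> because \<open>J\<close> is also a left ideal.\<close>
  let ?c = "\<lambda>v u. c v w \<otimes> (?e \<otimes> c w u) \<oplus> c v u"
  have rS: "r v = \<zero>" if "v \<in> S" for v
  proof (rule insert.IH[where c = ?c])
    fix v assume v: "v \<in> S"
    show "r v \<in> carrier R" using rc v by simp
    have "c v w \<otimes> r w = (\<Oplus>u\<in>S. c v w \<otimes> ((?e \<otimes> c w u) \<otimes> r u))"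
      unfolding rw using insert.hyps(1) e rc cc v by (intro finsum_rdistr) auto
    then have "r v = (\<Oplus>u\<in>S. c v w \<otimes> ((?e \<otimes> c w u) \<otimes> r u)) \<oplus> (\<Oplus>u\<in>S. c v u \<otimes> r u)"
      using split[of v] v by simp
    also have "\<dots> = (\<Oplus>u\<in>S. c v w \<otimes> ((?e \<otimes> c w u) \<otimes> r u) \<oplus> c v u \<otimes> r u)"
      using e rc cc v by (intro finsum_addf[symmetric]) auto
    also have "\<dots> = (\<Oplus>u\<in>S. ?c v u \<otimes> r u)"
      using e rc cc v by (intro finsum_cong') (auto simp: m_assoc l_distr)
    finally show "r v = (\<Oplus>u\<in>S. ?c v u \<otimes> r u)" .
  next
    fix v u assume "v \<in> S" "u \<in> S"
    then show "?c v u \<in> J"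
      using cJ e cc by (intro J_right_ideal(3) J_left_ideal) auto
  qed fact
  have "r w = (\<Oplus>u\<in>S. \<zero>)"
    unfolding rw using rS e cc by (intro finsum_cong') auto
  then have "r w = \<zero>" by simp
  then show ?case using rS insert.prems(4) by blast
qed

end

subsection \<open>Free modules and change of universe\<close>

text \<open>The free right module with the whole type \<open>'u\<close> as basis, encoded by
  finitely supported coordinate functions. It maps onto every module on \<open>'u\<close>, and by
  \<open>free_rmodule_lepoll\<close> it fits into an infinite \<open>'u\<close> that is at least as
  large as the ring.\<close>

definition free_rmodule :: "('a, 'c) ring_scheme \<Rightarrow> ('a, 'u \<Rightarrow> 'a) module"
  where "free_rmodule R =
    \<lparr>carrier = {f. (\<forall>u. f u \<in> carrier R) \<and> finite {u. f u \<noteq> \<zero>\<^bsub>R\<^esub>}},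
     monoid.mult = undefined, monoid.one = undefined, ring.zero = (\<lambda>_. \<zero>\<^bsub>R\<^esub>),
     ring.add = (\<lambda>f g u. f u \<oplus>\<^bsub>R\<^esub> g u), smult = (\<lambda>a f u. f u \<otimes>\<^bsub>R\<^esub> a)\<rparr>"

lemma free_rmodule_simps:
  "f \<in> carrier (free_rmodule R) \<longleftrightarrow> (\<forall>u. f u \<in> carrier R) \<and> finite {u. f u \<noteq> \<zero>\<^bsub>R\<^esub>}"
  "f \<oplus>\<^bsub>free_rmodule R\<^esub> g = (\<lambda>u. f u \<oplus>\<^bsub>R\<^esub> g u)"
  "\<zero>\<^bsub>free_rmodule R\<^esub> = (\<lambda>_. \<zero>\<^bsub>R\<^esub>)"
  "a \<odot>\<^bsub>free_rmodule R\<^esub> f = (\<lambda>u. f u \<otimes>\<^bsub>R\<^esub> a)"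
  by (simp_all add: free_rmodule_def)

lemma right_module_free:
  assumes "ring R"
  shows "right_module R (free_rmodule R :: ('a, 'u \<Rightarrow> 'a) module)"
proof -
  interpret ring R by fact
  let ?F = "free_rmodule R :: ('a, 'u \<Rightarrow> 'a) module"
  have add_fin: "finite {u. f u \<oplus>\<^bsub>R\<^esub> g u \<noteq> \<zero>\<^bsub>R\<^esub>}"
    if "finite {u. f u \<noteq> \<zero>\<^bsub>R\<^esub>}" "finite {u. g u \<noteq> \<zero>\<^bsub>R\<^esub>}" for f g :: "'u \<Rightarrow> 'a"
    by (rule finite_subset[OF _ finite_UnI[OF that]]) auto
  have scale_fin: "finite {u. f u \<otimes>\<^bsub>R\<^esub> a \<noteq> \<zero>\<^bsub>R\<^esub>}"
    if "finite {u. f u \<noteq> \<zero>\<^bsub>R\<^esub>}" "a \<in> carrier R" for f :: "'u \<Rightarrow> 'a" and a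
    by (rule finite_subset[OF _ that(1)]) (use that(2) in auto)
  have "abelian_group ?F"
  proof (rule abelian_groupI)
    fix f assume f: "f \<in> carrier ?F"
    let ?g = "\<lambda>u. f u \<otimes>\<^bsub>R\<^esub> (\<ominus>\<^bsub>R\<^esub> \<one>\<^bsub>R\<^esub>)"
    show "\<exists>g\<in>carrier ?F. g \<oplus>\<^bsub>?F\<^esub> f = \<zero>\<^bsub>?F\<^esub>"
    proof
      show "?g \<in> carrier ?F"
        using f scale_fin[of f "\<ominus>\<^bsub>R\<^esub> \<one>\<^bsub>R\<^esub>"] by (simp add: free_rmodule_simps)
      show "?g \<oplus>\<^bsub>?F\<^esub> f = \<zero>\<^bsub>?F\<^esub>"
        using f by (simp add: free_rmodule_simps r_minus l_neg)
    qed
  qed (auto simp: free_rmodule_simps a_ac add_fin)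
  then show ?thesis
    by (intro right_module.intro right_module_axioms.intro ring_axioms)
      (auto simp: free_rmodule_simps scale_fin l_distr r_distr m_assoc)
qed

text \<open>A finitely supported function is determined by its graph over the support, a finite
  subset of \<open>UNIV \<times> carrier R\<close>. For infinite \<open>'u\<close> there are no more
  finite subsets of \<open>'u \<times> 'u\<close> than elements of \<open>'u\<close>.\<close>

lemma free_rmodule_lepoll:
  assumes "infinite (UNIV :: 'u set)" "carrier R \<lesssim> (UNIV :: 'u set)"
  shows "carrier (free_rmodule R :: ('a, 'u \<Rightarrow> 'a) module) \<lesssim> (UNIV :: 'u set)"
proof -
  have "carrier (free_rmodule R :: ('a, 'u \<Rightarrow> 'a) module) =
      {f. f ` UNIV \<subseteq> carrier R \<and> {u. f u \<noteq> \<zero>\<^bsub>R\<^esub>} \<subseteq> UNIV \<and> finite {u. f u \<noteq> \<zero>\<^bsub>R\<^esub>}}"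
    by (auto simp: free_rmodule_def)
  also have "\<dots> \<lesssim> Fpow ((UNIV :: 'u set) \<times> carrier R)"
    by (rule lepoll_restricted_funspace)
  also have "Fpow ((UNIV :: 'u set) \<times> carrier R) \<lesssim> Fpow ((UNIV :: 'u set) \<times> (UNIV :: 'u set))"
  proof -
    obtain i :: "'a \<Rightarrow> 'u" where i: "inj_on i (carrier R)" using assms(2) unfolding lepoll_def by auto
    have "inj_on (map_prod id i) ((UNIV :: 'u set) \<times> carrier R)"
      using i by (auto simp: inj_on_def)
    then have "inj_on (image (map_prod id i)) (Fpow ((UNIV :: 'u set) \<times> carrier R))"
      by (rule inj_on_image_Fpow)
    moreover have "image (map_prod id i) ` Fpow ((UNIV :: 'u set) \<times> carrier R) \<subseteq> Fpow UNIV"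
      by (auto simp: Fpow_def)
    ultimately show ?thesis unfolding lepoll_def by auto
  qed
  also have "Fpow ((UNIV :: 'u set) \<times> (UNIV :: 'u set)) \<approx> (UNIV :: 'u set) \<times> (UNIV :: 'u set)"
    using assms(1) by (intro eqpoll_Fpow) (simp add: finite_prod)
  also have "(UNIV :: 'u set) \<times> (UNIV :: 'u set) \<approx> (UNIV :: 'u set)"
    unfolding eqpoll_iff_card_of_ordIso using assms(1) by (rule card_of_Times_same_infinite)
  finally show ?thesis .
qed

text \<open>Transport of structure along an injection into \<open>'u\<close>. Projectivity and
  perfectness speak only of modules on that type, so any other module has to be copied before they
  apply to it.\<close>

lemma right_module_copy:
  fixes M :: "('a, 'b, 'd) module_scheme"
  assumes "right_module R M" "carrier M \<lesssim> (UNIV :: 'u set)"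
  obtains N :: "('a, 'u) module" and h where
    "right_module R N" "h \<in> rmod_hom R M N" "bij_betw h (carrier M) (carrier N)"
proof -
  interpret right_module R M by fact
  obtain i :: "'b \<Rightarrow> 'u" where i: "inj_on i (carrier M)" using assms(2) unfolding lepoll_def by auto
  define j where "j = inv_into (carrier M) i"
  have j: "j (i x) = x" if "x \<in> carrier M" for x
    using i that by (simp add: j_def)
  define N :: "('a, 'u) module" where "N = \<lparr>carrier = i ` carrier M, monoid.mult = undefined,
    monoid.one = undefined, ring.zero = i \<zero>\<^bsub>M\<^esub>, ring.add = (\<lambda>x y. i (j x \<oplus>\<^bsub>M\<^esub> j y)),
    smult = (\<lambda>a x. i (a \<odot>\<^bsub>M\<^esub> j x))\<rparr>"
  have N: "carrier N = i ` carrier M" "\<zero>\<^bsub>N\<^esub> = i \<zero>\<^bsub>M\<^esub>"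
    "\<And>x y. x \<oplus>\<^bsub>N\<^esub> y = i (j x \<oplus>\<^bsub>M\<^esub> j y)" "\<And>a x. a \<odot>\<^bsub>N\<^esub> x = i (a \<odot>\<^bsub>M\<^esub> j x)"
    by (simp_all add: N_def)
  have "abelian_group N"
  proof (rule abelian_groupI)
    fix x assume "x \<in> carrier N"
    then obtain y where "y \<in> carrier M" "x = i y" by (auto simp: N)
    then show "\<exists>y\<in>carrier N. y \<oplus>\<^bsub>N\<^esub> x = \<zero>\<^bsub>N\<^esub>"
      by (intro bexI[of _ "i (\<ominus>\<^bsub>M\<^esub> y)"]) (auto simp: N j M.l_neg)
  qed (auto simp: N j M.a_ac)
  then have "right_module R N"
    by (intro right_module.intro right_module_axioms.intro R.ring_axioms)
      (auto simp: N j ract_closed ract_l_distr ract_r_distr ract_assoc ract_one)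
  moreover have "i \<in> rmod_hom R M N"
    by (rule rmod_homI) (auto simp: N j)
  moreover have "bij_betw i (carrier M) (carrier N)"
    using i by (simp add: N bij_betw_def)
  ultimately show ?thesis by (rule that)
qed

text \<open>As a function of \<open>f\<close> this is the homomorphism from the free module that
  extends \<open>s\<close> from the basis, see \<open>lincomb_hom\<close> and
  \<open>lincomb_single\<close>.\<close>

definition lincomb :: "('a, 'c) ring_scheme \<Rightarrow> ('a, 'b, 'd) module_scheme \<Rightarrow> ('u \<Rightarrow> 'b) \<Rightarrow> ('u \<Rightarrow> 'a) \<Rightarrow> 'b"
  where "lincomb R M s f = (\<Oplus>\<^bsub>M\<^esub>u\<in>{u. f u \<noteq> \<zero>\<^bsub>R\<^esub>}. f u \<odot>\<^bsub>M\<^esub> s u)"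

context right_module
begin

text \<open>Addition and the action can shrink supports, so linear combinations are compared over a
  common finite superset.\<close>

lemma lincomb_superset:
  assumes "\<And>u. s u \<in> carrier M" "\<And>u. f u \<in> carrier R" "finite H" "{u. f u \<noteq> \<zero>\<^bsub>R\<^esub>} \<subseteq> H"
  shows "lincomb R M s f = (\<Oplus>\<^bsub>M\<^esub>u\<in>H. f u \<odot>\<^bsub>M\<^esub> s u)"
  unfolding lincomb_def
  by (rule M.add.finprod_mono_neutral_cong_left) (use assms ract_closed in auto)

lemma lincomb_hom:
  assumes s: "\<And>u. s u \<in> carrier M"
  shows "lincomb R M s \<in> rmod_hom R (free_rmodule R) M"
proof (rule rmod_homI)
  interpret F: right_module R "free_rmodule R :: ('a, 'e \<Rightarrow> 'a) module"
    by (rule right_module_free[OF R.ring_axioms])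
  note simps = free_rmodule_simps
  fix f assume f: "f \<in> carrier (free_rmodule R :: ('a, 'e \<Rightarrow> 'a) module)"
  show "lincomb R M s f \<in> carrier M"
    unfolding lincomb_def using f s ract_closed by (intro M.finsum_closed) (auto simp: simps)
  show "lincomb R M s (f \<oplus>\<^bsub>free_rmodule R\<^esub> g) = lincomb R M s f \<oplus>\<^bsub>M\<^esub> lincomb R M s g"
    if g: "g \<in> carrier (free_rmodule R)" for g
  proof -
    let ?H = "{u. f u \<noteq> \<zero>\<^bsub>R\<^esub>} \<union> {u. g u \<noteq> \<zero>\<^bsub>R\<^esub>}"
    have H: "finite ?H" using f g by (simp add: simps)
    have "lincomb R M s (f \<oplus>\<^bsub>free_rmodule R\<^esub> g) = (\<Oplus>\<^bsub>M\<^esub>u\<in>?H. (f u \<oplus>\<^bsub>R\<^esub> g u) \<odot>\<^bsub>M\<^esub> s u)"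
      unfolding simps using f g s H by (intro lincomb_superset) (auto simp: simps)
    also have "\<dots> = (\<Oplus>\<^bsub>M\<^esub>u\<in>?H. f u \<odot>\<^bsub>M\<^esub> s u \<oplus>\<^bsub>M\<^esub> g u \<odot>\<^bsub>M\<^esub> s u)"
      using f g s by (intro M.finsum_cong') (auto simp: simps ract_l_distr ract_closed)
    also have "\<dots> = (\<Oplus>\<^bsub>M\<^esub>u\<in>?H. f u \<odot>\<^bsub>M\<^esub> s u) \<oplus>\<^bsub>M\<^esub> (\<Oplus>\<^bsub>M\<^esub>u\<in>?H. g u \<odot>\<^bsub>M\<^esub> s u)"
      using f g s by (intro M.finsum_addf) (auto simp: simps ract_closed)
    also have "(\<Oplus>\<^bsub>M\<^esub>u\<in>?H. f u \<odot>\<^bsub>M\<^esub> s u) = lincomb R M s f"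
      using f s H by (intro lincomb_superset[symmetric]) (auto simp: simps)
    also have "(\<Oplus>\<^bsub>M\<^esub>u\<in>?H. g u \<odot>\<^bsub>M\<^esub> s u) = lincomb R M s g"
      using g s H by (intro lincomb_superset[symmetric]) (auto simp: simps)
    finally show ?thesis .
  qed
  show "lincomb R M s (a \<odot>\<^bsub>free_rmodule R\<^esub> f) = a \<odot>\<^bsub>M\<^esub> lincomb R M s f"
    if a: "a \<in> carrier R" for a
  proof -
    let ?H = "{u. f u \<noteq> \<zero>\<^bsub>R\<^esub>}"
    have H: "finite ?H" using f by (simp add: simps)
    have "lincomb R M s (a \<odot>\<^bsub>free_rmodule R\<^esub> f) = (\<Oplus>\<^bsub>M\<^esub>u\<in>?H. (f u \<otimes>\<^bsub>R\<^esub> a) \<odot>\<^bsub>M\<^esub> s u)"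
      unfolding simps using f a s H by (intro lincomb_superset) (auto simp: simps)
    also have "\<dots> = (\<Oplus>\<^bsub>M\<^esub>u\<in>?H. a \<odot>\<^bsub>M\<^esub> (f u \<odot>\<^bsub>M\<^esub> s u))"
      using f a s by (intro M.finsum_cong') (auto simp: simps ract_assoc ract_closed)
    also have "\<dots> = a \<odot>\<^bsub>M\<^esub> lincomb R M s f"
      unfolding lincomb_def using f a s H
      by (intro finsum_ract[symmetric]) (auto simp: simps ract_closed)
    finally show ?thesis .
  qed
qed

lemma lincomb_single:
  assumes "s u \<in> carrier M"
  shows "(\<lambda>v. if v = u then \<one>\<^bsub>R\<^esub> else \<zero>\<^bsub>R\<^esub>) \<in> carrier (free_rmodule R)" (is "?d \<in> _")
    and "lincomb R M s (\<lambda>v. if v = u then \<one>\<^bsub>R\<^esub> else \<zero>\<^bsub>R\<^esub>) = s u"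
proof -
  have fin: "finite {v. ?d v \<noteq> \<zero>\<^bsub>R\<^esub>}"
    by (rule finite_subset[of _ "{u}"]) auto
  then show "?d \<in> carrier (free_rmodule R)" by (auto simp: free_rmodule_simps)
  show "lincomb R M s ?d = s u"
  proof (cases "\<one>\<^bsub>R\<^esub> = \<zero>\<^bsub>R\<^esub>")
    \<comment> \<open>Over the zero ring the basis vector has empty support, but then the module is
      zero as well.\<close>
    case True
    then have "s u = \<zero>\<^bsub>M\<^esub>" using ract_one[OF assms] assms by simp
    then show ?thesis using True by (simp add: lincomb_def)
  next
    case False
    then have "{v. ?d v \<noteq> \<zero>\<^bsub>R\<^esub>} = {u}" by auto
    then show ?thesis using assms by (simp add: lincomb_def ract_one)
  qed
qed

end

subsection \<open>Modules with MJ = M over a perfect local ring\<close>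

text \<open>This is the condition \<open>M J = M\<close>.\<close>

definition radical_full :: "('a, 'c) ring_scheme \<Rightarrow> 'a set \<Rightarrow> ('a, 'b, 'd) module_scheme \<Rightarrow> bool"
  where "radical_full R J M \<longleftrightarrow>
    (\<forall>L. submodule L R M \<longrightarrow> (\<forall>a\<in>J. \<forall>x\<in>carrier M. a \<odot>\<^bsub>M\<^esub> x \<in> L) \<longrightarrow> L = carrier M)"

lemma radical_fullD:
  assumes "radical_full R J M" "submodule L R M"
    and "\<And>a x. a \<in> J \<Longrightarrow> x \<in> carrier M \<Longrightarrow> a \<odot>\<^bsub>M\<^esub> x \<in> L"
  shows "L = carrier M"
  using assms unfolding radical_full_def by simp

text \<open>The preimage of a submodule that contains \<open>N J\<close> contains
  \<open>M J\<close>.\<close>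

lemma radical_full_image:
  assumes "right_module R M" "right_module R N" "h \<in> rmod_hom R M N"
    and "h ` carrier M = carrier N" "J \<subseteq> carrier R" "radical_full R J M"
  shows "radical_full R J N"
  unfolding radical_full_def
proof (intro allI impI)
  interpret rmod_homomorphism R M N h
    using assms by (intro rmod_homomorphism.intro rmod_homomorphism_axioms.intro)
  fix L assume L: "submodule L R N" "\<forall>a\<in>J. \<forall>x\<in>carrier N. a \<odot>\<^bsub>N\<^esub> x \<in> L"
  have "{x \<in> carrier M. h x \<in> L} = carrier M"
  proof (rule radical_fullD[OF assms(6) submodule_vimage[OF L(1)]])
    fix a x assume "a \<in> J" "x \<in> carrier M"
    moreover from this have "a \<in> carrier R" using assms(5) by blast
    ultimately show "a \<odot>\<^bsub>M\<^esub> x \<in> {x \<in> carrier M. h x \<in> L}"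
      using L(2) hom_closed by (simp add: M.ract_closed hom_ract)
  qed
  then have "carrier N \<subseteq> L" unfolding assms(4)[symmetric] by blast
  then show "L = carrier N" using N.submoduleD(1)[OF L(1)] by blast
qed

text \<open>If \<open>L\<close> contains \<open>P J\<close>, its image contains \<open>N J\<close>
  and is therefore all of \<open>N\<close>. Hence \<open>L\<close> and the kernel together span
  \<open>P\<close>, and smallness of the kernel gives \<open>L = P\<close>.\<close>

lemma radical_full_small_cover:
  assumes "right_module R P" "right_module R N" "p \<in> rmod_hom R P N"
    and "p ` carrier P = carrier N" "small_submodule (a_kernel P N p) R P"
    and "J \<subseteq> carrier R" "radical_full R J N"
  shows "radical_full R J P"
  unfolding radical_full_def
proof (intro allI impI)
  interpret rmod_homomorphism R P N p
    using assms by (intro rmod_homomorphism.intro rmod_homomorphism_axioms.intro)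
  fix L assume L: "submodule L R P" "\<forall>a\<in>J. \<forall>x\<in>carrier P. a \<odot>\<^bsub>P\<^esub> x \<in> L"
  note sub = M.submoduleD(1)[OF L(1)]
  have pL: "p ` L = carrier N"
  proof (rule radical_fullD[OF assms(7) submodule_image[OF L(1)]])
    fix a y assume a: "a \<in> J" "y \<in> carrier N"
    then obtain x where x: "x \<in> carrier P" "y = p x" using assms(4) by blast
    then have "a \<odot>\<^bsub>N\<^esub> y = p (a \<odot>\<^bsub>P\<^esub> x)" using a(1) assms(6) by (simp add: hom_ract subset_iff)
    then show "a \<odot>\<^bsub>N\<^esub> y \<in> p ` L" using L(2) a(1) x(1) by blast
  qed
  have K: "submodule (a_kernel P N p) R P" using assms(5) by (simp add: small_submodule_def)
  have "x \<in> a_kernel P N p <+>\<^bsub>P\<^esub> L" if x: "x \<in> carrier P" for x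
  proof -
    have "p x \<in> p ` L" using pL hom_closed[OF x] by simp
    then obtain l where l: "l \<in> L" "p x = p l" by blast
    have lc: "l \<in> carrier P" using l sub by blast
    then have "p (\<ominus>\<^bsub>P\<^esub> l) = \<ominus>\<^bsub>N\<^esub> p l"
      using M.ract_minus_one[OF lc, symmetric] N.ract_minus_one[OF hom_closed[OF lc]]
      by (simp add: hom_ract)
    then have "p (x \<ominus>\<^bsub>P\<^esub> l) = \<zero>\<^bsub>N\<^esub>"
      using x lc l(2) hom_closed by (simp add: M.M.minus_eq hom_add N.M.r_neg)
    then have "x \<ominus>\<^bsub>P\<^esub> l \<in> a_kernel P N p" using x lc by (simp add: a_kernel_def')
    moreover have "x = (x \<ominus>\<^bsub>P\<^esub> l) \<oplus>\<^bsub>P\<^esub> l"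
      using x lc by (simp add: M.M.minus_eq M.M.a_assoc M.M.l_neg)
    ultimately show ?thesis using l(1) unfolding M.mem_set_add_iff by blast
  qed
  then have "a_kernel P N p <+>\<^bsub>P\<^esub> L = carrier P"
    using M.submoduleD(1)[OF M.submodule_add(1)[OF K L(1)]] by blast
  then show "L = carrier P" using assms(5) L(1) by (simp add: small_submodule_def)
qed

context local_ring_radical
begin

lemma J_subset: "J \<subseteq> carrier R"
  using J_right_ideal(1) by blast

text \<open>By projectivity, \<open>P\<close> has a dual basis \<open>k\<close> on the generators \<open>s u\<close>. If \<open>P J = P\<close>, the
  coordinates of every element lie in \<open>J\<close>, so that the coordinates of \<open>x\<close> satisfy the hypothesis of
  Nakayama's lemma.\<close>

lemma projective_full_zero:
  fixes P :: "('a, 'u) module"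
  assumes "infinite (UNIV :: 'u set)" "carrier R \<lesssim> (UNIV :: 'u set)"
    and "projective_rmodule R P" "radical_full R J P"
  shows "carrier P = {\<zero>\<^bsub>P\<^esub>}"
proof -
  define F where "F = (free_rmodule R :: ('a, 'u \<Rightarrow> 'a) module)"
  interpret P: right_module R P using assms(3) by (simp add: projective_rmodule_def)
  interpret F: right_module R F unfolding F_def by (rule right_module_free[OF ring_axioms])
  \<comment> \<open>Projectivity of \<open>P\<close> is tested only against modules on
    \<open>'u\<close>, so the free module is replaced by a copy there.\<close>
  obtain F' :: "('a, 'u) module" and i where F': "right_module R F'" "i \<in> rmod_hom R F F'"
    "bij_betw i (carrier F) (carrier F')"
    using right_module_copy[OF F.right_module_axioms] free_rmodule_lepoll[OF assms(1,2)]
    unfolding F_def by blast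
  define i' where "i' = inv_into (carrier F) i"
  have i': "i' \<in> rmod_hom R F' F"
    unfolding i'_def by (rule rmod_hom_inv_into[OF F.right_module_axioms F'(2,3)])
  \<comment> \<open>Every element of \<open>P\<close> serves as a generator; the remaining basis
    indices are sent to zero.\<close>
  define s where "s u = (if u \<in> carrier P then u else \<zero>\<^bsub>P\<^esub>)" for u
  have s: "s u \<in> carrier P" for u by (simp add: s_def)
  let ?\<phi> = "lincomb R P s"
  have \<phi>: "?\<phi> \<in> rmod_hom R F P" unfolding F_def by (rule P.lincomb_hom[OF s])
  have g: "?\<phi> \<circ> i' \<in> rmod_hom R F' P" by (rule rmod_hom_comp[OF i' \<phi>])
  have "p \<in> (?\<phi> \<circ> i') ` carrier F'" if p: "p \<in> carrier P" for p
  proof -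
    let ?d = "\<lambda>v. if v = p then \<one> else \<zero>"
    have d: "?d \<in> carrier F" "?\<phi> ?d = s p" using P.lincomb_single[of s p, OF s] by (simp_all add: F_def)
    have "i ?d \<in> carrier F'" by (rule rmod_homD(1)[OF F'(2) d(1)])
    moreover have "(?\<phi> \<circ> i') (i ?d) = p"
      using d F'(3) p by (simp add: i'_def bij_betw_def s_def)
    ultimately show ?thesis by (metis imageI)
  qed
  then have surj: "(?\<phi> \<circ> i') ` carrier F' = carrier P"
    using rmod_homD(1)[OF g] by blast
  have "(\<lambda>x. x) \<in> rmod_hom R P P" by (rule rmod_homI) simp_all
  \<comment> \<open>Lifting the identity of \<open>P\<close> gives a section of the surjection from
    \<open>F'\<close>. Carried back to \<open>F\<close>, it assigns to each \<open>x\<close> its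
    coordinates \<open>k x\<close>.\<close>
  then obtain h where h: "h \<in> rmod_hom R P F'" "\<And>x. x \<in> carrier P \<Longrightarrow> (?\<phi> \<circ> i') (h x) = x"
    using assms(3) F'(1) P.right_module_axioms g surj unfolding projective_rmodule_def by blast
  define k where "k = i' \<circ> h"
  have k: "k \<in> rmod_hom R P F" unfolding k_def by (rule rmod_hom_comp[OF h(1) i'])
  have \<phi>k: "?\<phi> (k x) = x" if "x \<in> carrier P" for x using h(2)[OF that] by (simp add: k_def)
  have kF: "k x u \<in> carrier R" "finite {u. k x u \<noteq> \<zero>}" if "x \<in> carrier P" for x u
    using rmod_homD(1)[OF k that] by (auto simp: F_def free_rmodule_simps)
  have coord: "rmod_homomorphism R P (right_regular R) (\<lambda>x. k x v)" for v
  proof (intro rmod_homomorphism.intro rmod_homomorphism_axioms.intro P.right_module_axioms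
      right_module_regular)
    show "(\<lambda>x. k x v) \<in> rmod_hom R P (right_regular R)"
      using kF(1) rmod_homD(2,3)[OF k]
      by (intro rmod_homI) (simp_all add: F_def right_regular_def free_rmodule_simps)
  qed
  \<comment> \<open>The elements whose coordinate at \<open>v\<close> lies in \<open>J\<close> form
    a submodule. It contains \<open>P J\<close> because \<open>J\<close> is a left ideal, so it is
    all of \<open>P\<close>.\<close>
  have kJ: "k x v \<in> J" if "x \<in> carrier P" for x v
  proof -
    interpret c: rmod_homomorphism R P "right_regular R" "\<lambda>x. k x v" by (rule coord)
    have "submodule J R (right_regular R)" using maximal_J by (simp add: maximal_submodule_def)
    from c.submodule_vimage[OF this] have "{x \<in> carrier P. k x v \<in> J} = carrier P"
    proof (rule radical_fullD[OF assms(4)])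
      fix a x assume a: "a \<in> J" "x \<in> carrier P"
      then have "k (a \<odot>\<^bsub>P\<^esub> x) v = k x v \<otimes> a"
        using c.hom_ract[of a x] J_right_ideal(1) by (simp add: right_regular_def)
      then show "a \<odot>\<^bsub>P\<^esub> x \<in> {x \<in> carrier P. k x v \<in> J}"
        using a J_right_ideal(1) J_left_ideal kF(1) by (simp add: P.ract_closed)
    qed
    then show ?thesis using that by blast
  qed
  \<comment> \<open>Apply the coordinate at \<open>v\<close> to the expansion of \<open>x\<close> in
    the generators. With the right action the coefficients \<open>k (s u) v\<close> end up to the
    left of the unknowns \<open>k x u\<close>, as in \<open>nakayama\<close>.\<close>
  have expand: "k x v = (\<Oplus>u\<in>{u. k x u \<noteq> \<zero>}. k (s u) v \<otimes> k x u)" if x: "x \<in> carrier P" for x v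
  proof -
    interpret c: rmod_homomorphism R P "right_regular R" "\<lambda>x. k x v" by (rule coord)
    have "k x v = k (?\<phi> (k x)) v" by (simp add: \<phi>k x)
    also have "\<dots> = finsum (right_regular R) (\<lambda>u. k (k x u \<odot>\<^bsub>P\<^esub> s u) v) {u. k x u \<noteq> \<zero>}"
      unfolding lincomb_def using kF[OF x] s P.ract_closed by (intro c.hom_finsum) auto
    also have "\<dots> = (\<Oplus>u\<in>{u. k x u \<noteq> \<zero>}. k (k x u \<odot>\<^bsub>P\<^esub> s u) v)"
      by (simp add: finsum_right_regular)
    also have "\<dots> = (\<Oplus>u\<in>{u. k x u \<noteq> \<zero>}. k (s u) v \<otimes> k x u)"
      using c.hom_ract[OF kF(1)[OF x] s] kF(1)[OF x] kF(1)[OF s]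
      by (intro finsum_cong') (auto simp: right_regular_def)
    finally show ?thesis .
  qed
  have "x = \<zero>\<^bsub>P\<^esub>" if x: "x \<in> carrier P" for x
  proof -
    \<comment> \<open>The unknowns are the finitely many nonzero coordinates of \<open>x\<close>.
      Nakayama makes them vanish, so the support is empty and \<open>x\<close>, recovered from its
      coordinates, is zero.\<close>
    have "k x v = \<zero>" if "v \<in> {u. k x u \<noteq> \<zero>}" for v
    proof (rule nakayama[where S = "{u. k x u \<noteq> \<zero>}" and c = "\<lambda>v u. k (s u) v"])
      show "k x v = (\<Oplus>u\<in>{u. k x u \<noteq> \<zero>}. k (s u) v \<otimes> k x u)" for v by (rule expand[OF x])
    qed (use kF[OF x] kJ[OF s] that in auto)
    then have "{u. k x u \<noteq> \<zero>} = {}" by blast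
    then have "?\<phi> (k x) = \<zero>\<^bsub>P\<^esub>" unfolding lincomb_def by simp
    then show ?thesis using \<phi>k[OF x] by simp
  qed
  then show ?thesis by auto
qed

text \<open>The projective cover of \<open>N\<close> inherits the condition from \<open>N\<close>
  and therefore vanishes; \<open>N\<close> is its image.\<close>

lemma perfect_full_zero_small:
  fixes N :: "('a, 'u) module"
  assumes "infinite (UNIV :: 'u set)" "carrier R \<lesssim> (UNIV :: 'u set)"
    and "right_perfect TYPE('u) R" "right_module R N" "radical_full R J N"
  shows "carrier N = {\<zero>\<^bsub>N\<^esub>}"
proof -
  obtain P p where "projective_cover R P p N"
    using assms(3,4) unfolding right_perfect_def by blast
  then have P: "projective_rmodule R P" "p \<in> rmod_hom R P N" "p ` carrier P = carrier N"
    "small_submodule (a_kernel P N p) R P" by (simp_all add: projective_cover_def)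
  have P': "right_module R P" using P(1) by (simp add: projective_rmodule_def)
  have "carrier P = {\<zero>\<^bsub>P\<^esub>}"
    by (rule projective_full_zero[OF assms(1,2) P(1)])
      (rule radical_full_small_cover[OF P' assms(4) P(2,3,4) J_subset assms(5)])
  moreover have "p \<zero>\<^bsub>P\<^esub> = \<zero>\<^bsub>N\<^esub>"
    using P' P(2) assms(4)
    by (intro rmod_homomorphism.hom_zero rmod_homomorphism.intro rmod_homomorphism_axioms.intro)
  ultimately show ?thesis using P(3) by simp
qed

text \<open>A downward Loewenheim-Skolem argument removes the restriction on the carrier: every element
  \<open>y\<close> of \<open>M = M J\<close> lies in \<open>T J\<close> for some finite set \<open>T = T y\<close>, hence a countable set closed under
  \<open>T\<close> generates a submodule \<open>M'\<close> with \<open>M' J = M'\<close> that fits into \<open>'u\<close>.\<close>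

lemma perfect_full_zero:
  fixes M :: "('a, 'b, 'd) module_scheme"
  assumes inf: "infinite (UNIV :: 'u set)" and lep: "carrier R \<lesssim> (UNIV :: 'u set)"
    and perfect: "right_perfect TYPE('u) R" and M: "right_module R M" and full: "radical_full R J M"
  shows "carrier M = {\<zero>\<^bsub>M\<^esub>}"
proof -
  interpret M: right_module R M by (rule M)
  \<comment> \<open>This says that \<open>y\<close> belongs to the submodule \<open>T J\<close>
    generated by the products of elements of \<open>T\<close> with elements of \<open>J\<close>,
    without constructing that submodule.\<close>
  let ?gen = "\<lambda>T y. \<forall>L. submodule L R M \<longrightarrow> (\<forall>t\<in>T. \<forall>a\<in>J. a \<odot>\<^bsub>M\<^esub> t \<in> L) \<longrightarrow> y \<in> L"
  let ?L = "{y \<in> carrier M. \<exists>T. finite T \<and> T \<subseteq> carrier M \<and> ?gen T y}"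
  \<comment> \<open>The elements reached from finite sets form a submodule, as two finite sets can
    be united. It contains \<open>M J\<close>, where a singleton suffices.\<close>
  have "?L = carrier M"
  proof (rule radical_fullD[OF full])
    show "submodule ?L R M"
    proof (rule M.submoduleI)
      show "\<zero>\<^bsub>M\<^esub> \<in> ?L" using M.submoduleD(2) by blast
    next
      fix x y assume xy: "x \<in> ?L" "y \<in> ?L"
      then obtain T U where T: "finite T" "T \<subseteq> carrier M" "?gen T x"
        and U: "finite U" "U \<subseteq> carrier M" "?gen U y" by auto
      have "?gen (T \<union> U) (x \<oplus>\<^bsub>M\<^esub> y)" using T(3) U(3) M.submoduleD(3) by (metis UnCI)
      then show "x \<oplus>\<^bsub>M\<^esub> y \<in> ?L"
        using T(1,2) U(1,2) xy by (auto intro!: exI[of _ "T \<union> U"])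
    next
      fix a x assume a: "a \<in> carrier R" "x \<in> ?L"
      then obtain T where T: "finite T" "T \<subseteq> carrier M" "?gen T x" by auto
      have "?gen T (a \<odot>\<^bsub>M\<^esub> x)" using T(3) M.submoduleD(4) a(1) by metis
      then show "a \<odot>\<^bsub>M\<^esub> x \<in> ?L"
        using T(1,2) a M.ract_closed by (auto intro!: exI[of _ T])
    qed blast
    fix a x assume "a \<in> J" "x \<in> carrier M"
    then show "a \<odot>\<^bsub>M\<^esub> x \<in> ?L"
      using J_right_ideal(1) M.ract_closed by (auto intro!: exI[of _ "{x}"])
  qed
  then have "\<forall>y\<in>carrier M. \<exists>T. finite T \<and> T \<subseteq> carrier M \<and> ?gen T y" by blast
  from bchoice[OF this] obtain T where
    T: "\<forall>y\<in>carrier M. finite (T y) \<and> T y \<subseteq> carrier M \<and> ?gen (T y) y" by (rule exE)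
  have T_fin: "finite (T y)" "T y \<subseteq> carrier M" if "y \<in> carrier M" for y
    using T that by simp_all
  have T_gen: "y \<in> L" if "y \<in> carrier M" "submodule L R M"
    "\<And>t a. t \<in> T y \<Longrightarrow> a \<in> J \<Longrightarrow> a \<odot>\<^bsub>M\<^esub> t \<in> L" for y L
    using T that by simp
  have "x = \<zero>\<^bsub>M\<^esub>" if x: "x \<in> carrier M" for x
  proof -
    \<comment> \<open>\<open>S'\<close> iterates \<open>T\<close> from \<open>x\<close>. Each stage
      is finite, so the union \<open>S\<close> is a countable set containing \<open>x\<close> and
      closed under \<open>T\<close>.\<close>
    define S' where "S' = rec_nat {x} (\<lambda>_ A. \<Union>(T ` A))"
    define S where "S = (\<Union>n. S' n)"
    have S'_simps: "S' 0 = {x}" "S' (Suc n) = \<Union>(T ` S' n)" for n by (simp_all add: S'_def)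
    have S': "finite (S' n) \<and> S' n \<subseteq> carrier M" for n
    proof (induction n)
      case (Suc n)
      then have "\<And>y. y \<in> S' n \<Longrightarrow> y \<in> carrier M" by blast
      then show ?case using Suc T_fin by (auto simp: S'_simps dest: subsetD)
    qed (simp add: S'_simps x)
    have S: "countable S" "S \<subseteq> carrier M" "x \<in> S"
      unfolding S_def using S' S'_simps(1) by (auto intro: countable_finite)
    have TS: "T y \<subseteq> S" if "y \<in> S" for y
    proof -
      obtain n where "y \<in> S' n" using \<open>y \<in> S\<close> by (auto simp: S_def)
      then have "T y \<subseteq> S' (Suc n)" by (auto simp: S'_simps)
      then show ?thesis by (auto simp: S_def)
    qed
    \<comment> \<open>Being infinite, \<open>'u\<close> maps onto the naturals and hence onto the
      nonempty countable set \<open>S\<close>. The resulting listing \<open>s\<close> of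
      \<open>S\<close> is indexed by the basis of the free module.\<close>
    obtain c :: "nat \<Rightarrow> 'u" where "inj c" using inf infinite_countable_subset by blast
    then have surj: "surj (inv_into UNIV c)" by (rule inj_imp_surj_inv)
    define s where "s = from_nat_into S \<circ> inv_into UNIV c"
    have "range s = range (from_nat_into S)"
      unfolding s_def image_comp[symmetric] using surj by simp
    then have rs: "range s = S" using S(1,3) range_from_nat_into[of S] by blast
    have sM: "s u \<in> carrier M" for u using rs S(2) by blast
    define F where "F = (free_rmodule R :: ('a, 'u \<Rightarrow> 'a) module)"
    interpret h: rmod_homomorphism R F M "lincomb R M s"
      unfolding F_def using M.lincomb_hom[OF sM]
      by (intro rmod_homomorphism.intro rmod_homomorphism_axioms.intro right_module_free
        ring_axioms M.right_module_axioms)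
    \<comment> \<open>The submodule generated by \<open>S\<close>. Written as an image of the free
      module on \<open>'u\<close>, it is seen to be no larger than \<open>'u\<close>.\<close>
    define M' where "M' = lincomb R M s ` carrier F"
    have M': "submodule M' R M"
      unfolding M'_def by (rule h.submodule_image[OF h.M.submodule_carrier])
    have SM': "S \<subseteq> M'"
    proof
      fix y assume "y \<in> S"
      then obtain u where "y = s u" using rs by blast
      then show "y \<in> M'"
        unfolding M'_def F_def using M.lincomb_single[of s u, OF sM] by (metis imageI)
    qed
    have M'le: "M' \<lesssim> (UNIV :: 'u set)"
      unfolding M'_def F_def using image_lepoll free_rmodule_lepoll[OF inf lep] by (rule lepoll_trans)
    interpret M': right_module R "M\<lparr>carrier := M'\<rparr>" by (rule M.right_module_restrict[OF M'])
    \<comment> \<open>For \<open>y\<close> in \<open>S\<close> the set \<open>T y\<close> lies in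
      \<open>M'\<close>, so \<open>y\<close> lies in \<open>M' J\<close>. A submodule containing
      \<open>M' J\<close> thus contains the generators of \<open>M'\<close>.\<close>
    have full': "radical_full R J (M\<lparr>carrier := M'\<rparr>)"
      unfolding radical_full_def
    proof (intro allI impI)
      fix L assume "submodule L R (M\<lparr>carrier := M'\<rparr>)"
        and LJ: "\<forall>a\<in>J. \<forall>x\<in>carrier (M\<lparr>carrier := M'\<rparr>). a \<odot>\<^bsub>M\<lparr>carrier := M'\<rparr>\<^esub> x \<in> L"
      then have L: "submodule L R M" "L \<subseteq> M'" using M.submodule_restrict_iff[OF M'] by auto
      have sL: "s u \<in> L" for u
      proof -
        have "s u \<in> S" using rs by blast
        then have "T (s u) \<subseteq> M'" using TS SM' by blast
        then show ?thesis using T_gen[OF sM L(1)] LJ by (simp add: subset_iff)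
      qed
      have "lincomb R M s f \<in> L" if "f \<in> carrier F" for f
        unfolding lincomb_def using that sL M.submoduleD(4)[OF L(1)]
        by (intro M.finsum_in_submodule[OF L(1)]) (auto simp: F_def free_rmodule_simps)
      then show "L = carrier (M\<lparr>carrier := M'\<rparr>)" using L(2) by (auto simp: M'_def)
    qed
    \<comment> \<open>The copy of \<open>M'\<close> on \<open>'u\<close> is zero by the previous
      lemma, and injectivity of \<open>i\<close> identifies \<open>x\<close> with zero.\<close>
    obtain N :: "('a, 'u) module" and i where N: "right_module R N"
      "i \<in> rmod_hom R (M\<lparr>carrier := M'\<rparr>) N" "bij_betw i M' (carrier N)"
      using right_module_copy[OF M'.right_module_axioms, where 'u = 'u] M'le by auto
    have "radical_full R J N"
      by (rule radical_full_image[OF M'.right_module_axioms N(1,2) _ J_subset full'])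
        (use N(3) in \<open>simp add: bij_betw_def\<close>)
    then have "carrier N = {\<zero>\<^bsub>N\<^esub>}" by (rule perfect_full_zero_small[OF inf lep perfect N(1)])
    moreover have i: "inj_on i M'" "i ` M' = carrier N" using N(3) by (simp_all add: bij_betw_def)
    moreover have mem: "x \<in> M'" "\<zero>\<^bsub>M\<^esub> \<in> M'" using SM' S(3) M.submoduleD(2)[OF M'] by auto
    moreover have "i x \<in> i ` M'" "i \<zero>\<^bsub>M\<^esub> \<in> i ` M'" using mem by (simp_all only: imageI)
    ultimately have "i x = i \<zero>\<^bsub>M\<^esub>" by simp
    then show ?thesis using inj_onD[OF i(1)] mem by blast
  qed
  then show ?thesis by auto
qed

end

subsection \<open>Quotient modules and maximal submodules\<close>

context right_module
begin

lemma ract_diff_left: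
  assumes "a \<in> carrier R" "b \<in> carrier R" "x \<in> carrier M"
  shows "(a \<ominus>\<^bsub>R\<^esub> b) \<odot>\<^bsub>M\<^esub> x = a \<odot>\<^bsub>M\<^esub> x \<ominus>\<^bsub>M\<^esub> b \<odot>\<^bsub>M\<^esub> x"
  using assms by (simp add: R.minus_eq M.minus_eq ract_l_distr ract_minus_left)

lemma ract_minus_right:
  assumes "a \<in> carrier R" "x \<in> carrier M"
  shows "a \<odot>\<^bsub>M\<^esub> (\<ominus>\<^bsub>M\<^esub> x) = \<ominus>\<^bsub>M\<^esub> (a \<odot>\<^bsub>M\<^esub> x)"
proof -
  have "a \<odot>\<^bsub>M\<^esub> (\<ominus>\<^bsub>M\<^esub> x) \<oplus>\<^bsub>M\<^esub> a \<odot>\<^bsub>M\<^esub> x = \<zero>\<^bsub>M\<^esub>"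
    using ract_r_distr[of a "\<ominus>\<^bsub>M\<^esub> x" x] assms by (simp add: M.l_neg)
  then show ?thesis using assms ract_closed by (metis M.minus_equality M.a_inv_closed)
qed

lemma ract_diff_right:
  assumes "a \<in> carrier R" "x \<in> carrier M" "y \<in> carrier M"
  shows "a \<odot>\<^bsub>M\<^esub> (x \<ominus>\<^bsub>M\<^esub> y) = a \<odot>\<^bsub>M\<^esub> x \<ominus>\<^bsub>M\<^esub> a \<odot>\<^bsub>M\<^esub> y"
  using assms by (simp add: M.minus_eq ract_r_distr ract_minus_right)

lemma unit_ract_cancel:
  assumes "submodule N R M" "u \<in> Units R" "x \<in> carrier M" "u \<odot>\<^bsub>M\<^esub> x \<in> N"
  shows "x \<in> N"
proof -
  have "inv\<^bsub>R\<^esub> u \<odot>\<^bsub>M\<^esub> (u \<odot>\<^bsub>M\<^esub> x) = x"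
    using ract_assoc[of u "inv\<^bsub>R\<^esub> u" x] assms(2,3)
    by (simp add: ract_one R.Units_closed R.Units_inv_closed R.Units_r_inv)
  then show ?thesis using submoduleD(4)[OF assms(1) R.Units_inv_closed[OF assms(2)] assms(4)] by simp
qed

lemma mem_coset_iff:
  assumes "submodule A R M" "m \<in> carrier M"
  shows "y \<in> A +>\<^bsub>M\<^esub> m \<longleftrightarrow> y \<in> carrier M \<and> y \<ominus>\<^bsub>M\<^esub> m \<in> A"
proof
  note sub = submoduleD(1)[OF assms(1)]
  assume "y \<in> A +>\<^bsub>M\<^esub> m"
  then obtain a where a: "a \<in> A" "y = a \<oplus>\<^bsub>M\<^esub> m" by (auto simp: a_r_coset_def')
  then show "y \<in> carrier M \<and> y \<ominus>\<^bsub>M\<^esub> m \<in> A"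
    using assms(2) sub by (auto simp: M.minus_eq M.a_assoc M.r_neg)
next
  assume y: "y \<in> carrier M \<and> y \<ominus>\<^bsub>M\<^esub> m \<in> A"
  then have "y = (y \<ominus>\<^bsub>M\<^esub> m) \<oplus>\<^bsub>M\<^esub> m" using assms(2) by (simp add: M.minus_eq M.a_assoc M.l_neg)
  then show "y \<in> A +>\<^bsub>M\<^esub> m" using y unfolding a_r_coset_def' by blast
qed

lemma abelian_subgroup_submodule: "submodule A R M \<Longrightarrow> abelian_subgroup A M"
  by (intro abelian_subgroupI3 additive_subgroup.intro M.abelian_group_axioms submodule.axioms(1))

lemma coset_eq_iff:
  assumes "submodule A R M" "m \<in> carrier M" "n \<in> carrier M"
  shows "A +>\<^bsub>M\<^esub> m = A +>\<^bsub>M\<^esub> n \<longleftrightarrow> m \<ominus>\<^bsub>M\<^esub> n \<in> A"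
proof
  assume "A +>\<^bsub>M\<^esub> m = A +>\<^bsub>M\<^esub> n"
  moreover have "m \<in> A +>\<^bsub>M\<^esub> m"
    using assms submoduleD(2) by (simp add: mem_coset_iff M.minus_eq M.r_neg)
  ultimately show "m \<ominus>\<^bsub>M\<^esub> n \<in> A" using assms by (simp add: mem_coset_iff)
next
  assume "m \<ominus>\<^bsub>M\<^esub> n \<in> A"
  then have "m \<in> A +>\<^bsub>M\<^esub> n" using assms by (simp add: mem_coset_iff)
  then show "A +>\<^bsub>M\<^esub> m = A +>\<^bsub>M\<^esub> n"
    using M.a_repr_independence[OF _ assms(3)] submodule.axioms(1)[OF assms(1)] by simp
qed

lemma carrier_quot_module: "carrier (quot_module M A) = (\<lambda>m. A +>\<^bsub>M\<^esub> m) ` carrier M"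
  by (auto simp: quot_module_def A_RCOSETS_def')

lemma add_quot_module:
  assumes "submodule A R M" "m \<in> carrier M" "n \<in> carrier M"
  shows "(A +>\<^bsub>M\<^esub> m) \<oplus>\<^bsub>quot_module M A\<^esub> (A +>\<^bsub>M\<^esub> n) = A +>\<^bsub>M\<^esub> (m \<oplus>\<^bsub>M\<^esub> n)"
  using abelian_subgroup.a_rcos_sum[OF abelian_subgroup_submodule[OF assms(1)] assms(2,3)]
  by (simp add: quot_module_def)

text \<open>The action on a coset is a union over its representatives. All of them yield the same
  coset and there is at least one, so the union collapses.\<close>

lemma ract_quot_module:
  assumes "submodule A R M" "a \<in> carrier R" "m \<in> carrier M"
  shows "a \<odot>\<^bsub>quot_module M A\<^esub> (A +>\<^bsub>M\<^esub> m) = A +>\<^bsub>M\<^esub> (a \<odot>\<^bsub>M\<^esub> m)"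
proof -
  have "A +>\<^bsub>M\<^esub> (a \<odot>\<^bsub>M\<^esub> y) = A +>\<^bsub>M\<^esub> (a \<odot>\<^bsub>M\<^esub> m)" if "y \<in> A +>\<^bsub>M\<^esub> m" for y
  proof -
    have y: "y \<in> carrier M" "y \<ominus>\<^bsub>M\<^esub> m \<in> A" using that assms by (simp_all add: mem_coset_iff)
    then have "a \<odot>\<^bsub>M\<^esub> y \<ominus>\<^bsub>M\<^esub> a \<odot>\<^bsub>M\<^esub> m \<in> A"
      using submoduleD(4)[OF assms(1,2) y(2)] assms by (simp add: ract_diff_right)
    then show ?thesis using assms y by (simp add: coset_eq_iff ract_closed)
  qed
  then have "(\<Union>y\<in>A +>\<^bsub>M\<^esub> m. A +>\<^bsub>M\<^esub> (a \<odot>\<^bsub>M\<^esub> y)) = (\<Union>y\<in>A +>\<^bsub>M\<^esub> m. A +>\<^bsub>M\<^esub> (a \<odot>\<^bsub>M\<^esub> m))"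
    by (rule SUP_cong[OF refl])
  moreover have "A +>\<^bsub>M\<^esub> m \<noteq> {}"
    using assms submoduleD(2) mem_coset_iff[of A m m] by (auto simp: M.minus_eq M.r_neg)
  ultimately show ?thesis by (simp add: quot_module_def)
qed

lemma set_add_subset:
  assumes "submodule N R M" "A \<subseteq> N" "B \<subseteq> N"
  shows "A <+>\<^bsub>M\<^esub> B \<subseteq> N"
proof
  fix x assume "x \<in> A <+>\<^bsub>M\<^esub> B"
  then obtain a b where "a \<in> A" "b \<in> B" "x = a \<oplus>\<^bsub>M\<^esub> b" unfolding mem_set_add_iff by blast
  then show "x \<in> N" using assms(2,3) submoduleD(3)[OF assms(1)] by (simp add: subset_iff)
qed

lemma set_add_commute:
  assumes "A \<subseteq> carrier M" "B \<subseteq> carrier M"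
  shows "A <+>\<^bsub>M\<^esub> B = B <+>\<^bsub>M\<^esub> A"
proof -
  have "a \<oplus>\<^bsub>M\<^esub> b = b \<oplus>\<^bsub>M\<^esub> a" if "a \<in> A" "b \<in> B" for a b
    using that assms by (intro M.a_comm) auto
  then show ?thesis unfolding set_eq_iff mem_set_add_iff by metis
qed

text \<open>\<open>N\<close> itself is a complement: the intersection is zero by simplicity of
  \<open>B\<close>, and the sum is everything by maximality of \<open>N\<close>.\<close>

lemma direct_summand_simple_maximal:
  assumes "maximal_submodule N R M" "simple_submodule B R M" "\<not> B \<subseteq> N"
  shows "direct_summand B R M"
proof -
  have N: "submodule N R M" using assms(1) by (simp add: maximal_submodule_def)
  have B: "submodule B R M" by (rule simple_submoduleD[OF assms(2)])
  have "B <+>\<^bsub>M\<^esub> N = carrier M"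
    using maximal_submodule_add[OF assms(1) B assms(3)]
      set_add_commute[OF submoduleD(1)[OF N] submoduleD(1)[OF B]] by simp
  then show ?thesis
    unfolding direct_summand_def
    using N B simple_submodule_Int[OF assms(2) N assms(3)] by blast
qed

text \<open>If \<open>D \<subseteq> C\<close> is not inside \<open>A\<close>, then \<open>A\<close>
  and \<open>D\<close> span \<open>M\<close>. Writing \<open>c = a \<oplus> d\<close> puts
  \<open>a = c \<ominus> d\<close> into \<open>A \<inter> C\<close>, so
  \<open>c = d\<close>.\<close>

lemma complement_maximal_simple:
  assumes A: "maximal_submodule A R M" and C: "submodule C R M"
    and int: "A \<inter> C = {\<zero>\<^bsub>M\<^esub>}" and sum: "A <+>\<^bsub>M\<^esub> C = carrier M"
  shows "simple_submodule C R M"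
  unfolding simple_submodule_iff
proof (intro conjI allI impI C)
  have As: "submodule A R M" "A \<noteq> carrier M" using A by (simp_all add: maximal_submodule_def)
  show "C \<noteq> {\<zero>\<^bsub>M\<^esub>}"
  proof
    assume "C = {\<zero>\<^bsub>M\<^esub>}"
    then have "A <+>\<^bsub>M\<^esub> C \<subseteq> A"
      using submoduleD(2)[OF As(1)] by (intro set_add_subset[OF As(1)]) auto
    then show False using sum As submoduleD(1)[OF As(1)] by blast
  qed
  fix D assume "submodule D R M \<and> D \<subseteq> C"
  then have D: "submodule D R M" "D \<subseteq> C" by auto
  show "D = {\<zero>\<^bsub>M\<^esub>} \<or> D = C"
  proof (cases "D \<subseteq> A")
    case True
    then show ?thesis using D int submoduleD(2)[OF D(1)] by blast
  next
    case False
    then have AD: "A <+>\<^bsub>M\<^esub> D = carrier M" by (rule maximal_submodule_add[OF A D(1)])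
    have "c \<in> D" if c: "c \<in> C" for c
    proof -
      have cM: "c \<in> carrier M" using c submoduleD(1)[OF C] by blast
      then obtain a d where ad: "a \<in> A" "d \<in> D" "c = a \<oplus>\<^bsub>M\<^esub> d"
        using AD unfolding mem_set_add_iff[symmetric] by (metis mem_set_add_iff)
      have aM: "a \<in> carrier M" "d \<in> carrier M"
        using ad submoduleD(1)[OF As(1)] submoduleD(1)[OF D(1)] by auto
      have "c \<ominus>\<^bsub>M\<^esub> d \<in> C" using submodule_diff[OF C c] ad(2) D(2) by blast
      moreover have "c \<ominus>\<^bsub>M\<^esub> d = a" using aM ad(3) by (simp add: M.minus_eq M.a_assoc M.r_neg)
      ultimately have "a = \<zero>\<^bsub>M\<^esub>" using ad(1) int by blast
      then show ?thesis using ad aM by simp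
    qed
    then show ?thesis using D(2) by blast
  qed
qed

text \<open>The dual argument: if \<open>L\<close> above \<open>C\<close> does not contain
  \<open>B\<close>, it meets \<open>B\<close> in zero. Writing \<open>l = b \<oplus> c\<close> puts
  \<open>b = l \<ominus> c\<close> into \<open>B \<inter> L\<close>, so
  \<open>l = c\<close>.\<close>

lemma complement_simple_maximal:
  assumes B: "simple_submodule B R M" and C: "submodule C R M"
    and int: "B \<inter> C = {\<zero>\<^bsub>M\<^esub>}" and sum: "B <+>\<^bsub>M\<^esub> C = carrier M"
  shows "maximal_submodule C R M"
  unfolding maximal_submodule_def
proof (intro conjI allI impI C)
  have Bs: "submodule B R M" "B \<noteq> {\<zero>\<^bsub>M\<^esub>}" using B by (simp_all add: simple_submodule_iff)
  show "C \<noteq> carrier M" using Bs int submoduleD(1)[OF Bs(1)] by blast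
  fix L assume "submodule L R M \<and> C \<subseteq> L"
  then have L: "submodule L R M" "C \<subseteq> L" by auto
  show "L = C \<or> L = carrier M"
  proof (cases "B \<subseteq> L")
    case True
    then have "B <+>\<^bsub>M\<^esub> C \<subseteq> L" using L by (intro set_add_subset)
    then show ?thesis using sum submoduleD(1)[OF L(1)] by blast
  next
    case False
    then have BL: "B \<inter> L = {\<zero>\<^bsub>M\<^esub>}" by (rule simple_submodule_Int[OF B L(1)])
    have "l \<in> C" if l: "l \<in> L" for l
    proof -
      have "l \<in> B <+>\<^bsub>M\<^esub> C" using l submoduleD(1)[OF L(1)] sum by blast
      then obtain b c where bc: "b \<in> B" "c \<in> C" "l = b \<oplus>\<^bsub>M\<^esub> c" unfolding mem_set_add_iff by blast
      have bM: "b \<in> carrier M" "c \<in> carrier M"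
        using bc submoduleD(1)[OF Bs(1)] submoduleD(1)[OF C] by auto
      have "l \<ominus>\<^bsub>M\<^esub> c \<in> L" using submodule_diff[OF L(1) l] bc(2) L(2) by blast
      moreover have "l \<ominus>\<^bsub>M\<^esub> c = b" using bM bc(3) by (simp add: M.minus_eq M.a_assoc M.r_neg)
      ultimately have "b = \<zero>\<^bsub>M\<^esub>" using bc(1) BL by blast
      then show ?thesis using bc bM by simp
    qed
    then show ?thesis using L(2) by blast
  qed
qed

text \<open>A simple submodule \<open>B'\<close> not contained in \<open>A\<close> is a complement of \<open>A\<close>, because \<open>M/A\<close> is simple.\<close>

lemma semisimple_direct_summand:
  assumes ss: "soc R M = carrier M" and A: "submodule A R M" and B: "simple_submodule B R M"
    and iso: "rmod_isomorphic R (quot_module M A) (M\<lparr>carrier := B\<rparr>)"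
  shows "direct_summand A R M"
proof -
  let ?Q = "quot_module M A" and ?c = "\<lambda>m. A +>\<^bsub>M\<^esub> m"
  obtain h where h: "h \<in> rmod_hom R ?Q (M\<lparr>carrier := B\<rparr>)" and bij: "bij_betw h (carrier ?Q) B"
    using iso unfolding rmod_isomorphic_def by auto
  have c: "?c m \<in> carrier ?Q" if "m \<in> carrier M" for m using that by (simp add: carrier_quot_module)
  have hc: "h (?c m) \<in> B" if "m \<in> carrier M" for m using rmod_homD(1)[OF h c[OF that]] by simp
  have hcM: "h (?c m) \<in> carrier M" if "m \<in> carrier M" for m
    using simple_submoduleD(2)[OF B hc[OF that]] .
  have inj: "m \<ominus>\<^bsub>M\<^esub> n \<in> A" if "m \<in> carrier M" "n \<in> carrier M" "h (?c m) = h (?c n)" for m n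
  proof -
    have "?c m = ?c n" using bij c that by (auto simp: bij_betw_def dest: inj_onD)
    then show ?thesis using coset_eq_iff[OF A] that by simp
  qed
  \<comment> \<open>The map from \<open>M\<close> to \<open>B\<close> induced by \<open>h\<close>
    has kernel \<open>A\<close>.\<close>
  have h0: "h (?c m) = \<zero>\<^bsub>M\<^esub> \<longleftrightarrow> m \<in> A" if m: "m \<in> carrier M" for m
  proof -
    have "h (?c \<zero>\<^bsub>M\<^esub>) \<oplus>\<^bsub>M\<^esub> h (?c \<zero>\<^bsub>M\<^esub>) = h (?c \<zero>\<^bsub>M\<^esub>)"
      using rmod_homD(2)[OF h c c, of "\<zero>\<^bsub>M\<^esub>" "\<zero>\<^bsub>M\<^esub>"] add_quot_module[OF A, of "\<zero>\<^bsub>M\<^esub>" "\<zero>\<^bsub>M\<^esub>"] by simp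
    then have z: "h (?c \<zero>\<^bsub>M\<^esub>) = \<zero>\<^bsub>M\<^esub>" using hcM[of "\<zero>\<^bsub>M\<^esub>"] by (simp add: M.add.l_cancel_one)
    have "m \<ominus>\<^bsub>M\<^esub> \<zero>\<^bsub>M\<^esub> = m" using m by (simp add: M.minus_eq)
    then show ?thesis
      using inj[OF m, of "\<zero>\<^bsub>M\<^esub>"] coset_eq_iff[OF A m, of "\<zero>\<^bsub>M\<^esub>"] z by auto
  qed
  have "A \<noteq> carrier M"
  proof
    assume "A = carrier M"
    then have "h ` carrier ?Q \<subseteq> {\<zero>\<^bsub>M\<^esub>}" using h0 by (auto simp: carrier_quot_module)
    then have "B \<subseteq> {\<zero>\<^bsub>M\<^esub>}" using bij by (simp add: bij_betw_def)
    then show False using B simple_submoduleD(3)[OF B] by (auto simp: simple_submodule_iff)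
  qed
  then obtain B' where B': "simple_submodule B' R M" "\<not> B' \<subseteq> A"
    using soc_least[OF A] ss submoduleD(1)[OF A] by blast
  note B's = simple_submoduleD[OF B'(1)]
  obtain b where b: "b \<in> B'" "b \<notin> A" using B'(2) by blast
  have bM: "b \<in> carrier M" using B's(2) b by blast
  have "m \<in> A <+>\<^bsub>M\<^esub> B'" if m: "m \<in> carrier M" for m
  proof -
    \<comment> \<open>This nonzero element generates \<open>B\<close>, so the class of
      \<open>m\<close> is a multiple of the class of \<open>b\<close>. Hence \<open>m\<close>
      differs from an element of \<open>B'\<close> by an element of \<open>A\<close>.\<close>
    have "h (?c b) \<noteq> \<zero>\<^bsub>M\<^esub>" using h0[OF bM] b by simp
    then obtain a where a: "a \<in> carrier R" "h (?c m) = a \<odot>\<^bsub>M\<^esub> h (?c b)"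
      using simple_submodule_cyclic[OF B hc[OF bM] _ hc[OF m]] by blast
    have "h (?c m) = h (?c (a \<odot>\<^bsub>M\<^esub> b))"
      using a rmod_homD(3)[OF h a(1) c[OF bM]] ract_quot_module[OF A a(1) bM] by simp
    then have "m \<ominus>\<^bsub>M\<^esub> a \<odot>\<^bsub>M\<^esub> b \<in> A" using inj m a bM by (simp add: ract_closed)
    moreover have "m = (m \<ominus>\<^bsub>M\<^esub> a \<odot>\<^bsub>M\<^esub> b) \<oplus>\<^bsub>M\<^esub> a \<odot>\<^bsub>M\<^esub> b"
      using m a(1) bM by (simp add: ract_closed M.minus_eq M.a_assoc M.l_neg)
    ultimately show ?thesis using B's(5)[OF a(1) b(1)] unfolding mem_set_add_iff by blast
  qed
  then have "A <+>\<^bsub>M\<^esub> B' = carrier M"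
    using submoduleD(1)[OF submodule_add(1)[OF A B's(1)]] by blast
  moreover have "A \<inter> B' = {\<zero>\<^bsub>M\<^esub>}" using simple_submodule_Int[OF B'(1) A B'(2)] by blast
  ultimately show ?thesis unfolding direct_summand_def using A B's(1) by blast
qed

end

subsection \<open>Modules over a local ring\<close>

locale local_ring_module = local_ring_radical R J + right_module R M
  for R :: "('a, 'c) ring_scheme" and J and M :: "('a, 'b, 'd) module_scheme"
begin

text \<open>The difference is \<open>x\<close> acted on by \<open>\<one> \<ominus> j\<close>, which
  is a unit.\<close>

lemma one_minus_J_ract_cancel:
  assumes "submodule N R M" "j \<in> J" "x \<in> carrier M" "x \<ominus>\<^bsub>M\<^esub> j \<odot>\<^bsub>M\<^esub> x \<in> N"
  shows "x \<in> N"
proof (rule unit_ract_cancel[OF assms(1) one_minus_J_unit[OF assms(2)] assms(3)])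
  show "(\<one>\<^bsub>R\<^esub> \<ominus>\<^bsub>R\<^esub> j) \<odot>\<^bsub>M\<^esub> x \<in> N"
    using assms J_right_ideal(1) by (simp add: ract_diff_left ract_one)
qed

text \<open>If the product were nonzero it would generate \<open>B\<close>. Then \<open>b\<close>
  would be its own product with \<open>j \<otimes> r\<close>, an element of \<open>J\<close>, and
  would be zero by cancellation.\<close>

lemma simple_ract_J:
  assumes B: "simple_submodule B R M" and "b \<in> B" "j \<in> J"
  shows "j \<odot>\<^bsub>M\<^esub> b = \<zero>\<^bsub>M\<^esub>"
proof (rule ccontr)
  assume nz: "j \<odot>\<^bsub>M\<^esub> b \<noteq> \<zero>\<^bsub>M\<^esub>"
  have j: "j \<in> carrier R" and b: "b \<in> carrier M"
    using assms J_right_ideal(1) simple_submoduleD(2)[OF B] by auto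
  obtain r where r: "r \<in> carrier R" "b = r \<odot>\<^bsub>M\<^esub> (j \<odot>\<^bsub>M\<^esub> b)"
    using simple_submodule_cyclic[OF B simple_submoduleD(5)[OF B j assms(2)] nz assms(2)] .
  have "b = (j \<otimes>\<^bsub>R\<^esub> r) \<odot>\<^bsub>M\<^esub> b" using r j b by (simp add: ract_assoc)
  then have "b \<ominus>\<^bsub>M\<^esub> (j \<otimes>\<^bsub>R\<^esub> r) \<odot>\<^bsub>M\<^esub> b \<in> {\<zero>\<^bsub>M\<^esub>}" using b by (metis M.minus_eq M.r_neg singletonI)
  then have "b = \<zero>\<^bsub>M\<^esub>"
    using one_minus_J_ract_cancel[OF submodule_zero J_right_ideal(4)[OF assms(3) r(1)] b] by simp
  then show False using nz j by simp
qed

text \<open>The argument of \<open>simple_ract_J\<close> carried out modulo \<open>A\<close>; it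
  shows that \<open>M J\<close> lies in every maximal submodule.\<close>

lemma maximal_ract_J:
  assumes A: "maximal_submodule A R M" and "y \<in> carrier M" "j \<in> J"
  shows "j \<odot>\<^bsub>M\<^esub> y \<in> A"
proof (rule ccontr)
  assume notin: "j \<odot>\<^bsub>M\<^esub> y \<notin> A"
  have As: "submodule A R M" using A by (simp add: maximal_submodule_def)
  have j: "j \<in> carrier R" using assms(3) J_right_ideal(1) by blast
  obtain a r where ar: "a \<in> A" "r \<in> carrier R" "y = a \<oplus>\<^bsub>M\<^esub> r \<odot>\<^bsub>M\<^esub> (j \<odot>\<^bsub>M\<^esub> y)"
    using maximal_submodule_decompose[OF A ract_closed[OF j assms(2)] notin assms(2)] .
  have aM: "a \<in> carrier M" using ar(1) submoduleD(1)[OF As] by blast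
  let ?z = "(j \<otimes>\<^bsub>R\<^esub> r) \<odot>\<^bsub>M\<^esub> y"
  have z: "?z \<in> carrier M" using j ar(2) assms(2) ract_closed by simp
  have "y = a \<oplus>\<^bsub>M\<^esub> ?z" using ar j assms(2) by (simp add: ract_assoc)
  then have "y \<ominus>\<^bsub>M\<^esub> ?z = a \<oplus>\<^bsub>M\<^esub> ?z \<ominus>\<^bsub>M\<^esub> ?z" by simp
  then have "y \<ominus>\<^bsub>M\<^esub> ?z \<in> A" using aM z ar(1) by (simp add: M.minus_eq M.a_assoc M.r_neg)
  then have "y \<in> A"
    using one_minus_J_ract_cancel[OF As J_right_ideal(4)[OF assms(3) ar(2)] assms(2)] by simp
  then show False using notin submoduleD(4)[OF As j] by simp
qed

text \<open>Both \<open>M/A\<close> and \<open>B\<close> are isomorphic to \<open>R/J\<close>; the isomorphism sends the class of \<open>x r\<close> to \<open>b r\<close>.\<close>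

lemma maximal_quotient_isomorphic_simple:
  assumes A: "maximal_submodule A R M" and B: "simple_submodule B R M"
  shows "rmod_isomorphic R (quot_module M A) (M\<lparr>carrier := B\<rparr>)"
proof -
  let ?c = "\<lambda>m. A +>\<^bsub>M\<^esub> m"
  note Bs = simple_submoduleD[OF B]
  have As: "submodule A R M" "A \<noteq> carrier M" using A by (simp_all add: maximal_submodule_def)
  then obtain x where x: "x \<in> carrier M" "x \<notin> A" using submoduleD(1)[OF As(1)] by blast
  obtain b where b: "b \<in> B" "b \<noteq> \<zero>\<^bsub>M\<^esub>" using B Bs(3) by (auto simp: simple_submodule_iff)
  have bM: "b \<in> carrier M" using Bs(2) b by blast
  \<comment> \<open>The class of \<open>x\<close> in \<open>M/A\<close> and the element
    \<open>b\<close> have the same annihilator \<open>J\<close>: elements of \<open>J\<close> kill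
    both, and all others are units.\<close>
  have annx: "c \<odot>\<^bsub>M\<^esub> x \<in> A \<longleftrightarrow> c \<in> J" if c: "c \<in> carrier R" for c
    using maximal_ract_J[OF A x(1)] unit_ract_cancel[OF As(1) unit_notin_J x(1)] x(2) c by blast
  have annb: "c \<odot>\<^bsub>M\<^esub> b = \<zero>\<^bsub>M\<^esub> \<longleftrightarrow> c \<in> J" if c: "c \<in> carrier R" for c
    using simple_ract_J[OF B b(1)] unit_ract_cancel[OF submodule_zero unit_notin_J bM] b(2) c by blast
  have key: "r \<odot>\<^bsub>M\<^esub> x \<ominus>\<^bsub>M\<^esub> s \<odot>\<^bsub>M\<^esub> x \<in> A \<longleftrightarrow> r \<odot>\<^bsub>M\<^esub> b = s \<odot>\<^bsub>M\<^esub> b"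
    if "r \<in> carrier R" "s \<in> carrier R" for r s
  proof -
    have "r \<odot>\<^bsub>M\<^esub> x \<ominus>\<^bsub>M\<^esub> s \<odot>\<^bsub>M\<^esub> x \<in> A \<longleftrightarrow> r \<odot>\<^bsub>M\<^esub> b \<ominus>\<^bsub>M\<^esub> s \<odot>\<^bsub>M\<^esub> b = \<zero>\<^bsub>M\<^esub>"
      using annx[of "r \<ominus>\<^bsub>R\<^esub> s"] annb[of "r \<ominus>\<^bsub>R\<^esub> s"] that x(1) bM by (simp add: ract_diff_left)
    also have "\<dots> \<longleftrightarrow> r \<odot>\<^bsub>M\<^esub> b = s \<odot>\<^bsub>M\<^esub> b"
      using that bM ract_closed
      by (metis M.minus_eq M.minus_equality M.minus_minus M.r_neg M.a_inv_closed)
    finally show ?thesis .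
  qed
  \<comment> \<open>The scalar \<open>r\<close> representing a coset is unique only modulo
    \<open>J\<close>, but by \<open>key\<close> the value at \<open>b\<close> does not depend on the
    choice. The converse direction of \<open>key\<close> gives injectivity.\<close>
  define h where "h X = (THE y. \<exists>r\<in>carrier R. r \<odot>\<^bsub>M\<^esub> x \<in> X \<and> y = r \<odot>\<^bsub>M\<^esub> b)" for X
  have h: "h (?c (r \<odot>\<^bsub>M\<^esub> x)) = r \<odot>\<^bsub>M\<^esub> b" if r: "r \<in> carrier R" for r
    unfolding h_def
  proof (rule the_equality)
    have iff: "s \<odot>\<^bsub>M\<^esub> x \<in> ?c (r \<odot>\<^bsub>M\<^esub> x) \<longleftrightarrow> s \<odot>\<^bsub>M\<^esub> b = r \<odot>\<^bsub>M\<^esub> b" if "s \<in> carrier R" for s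
      using mem_coset_iff[OF As(1) ract_closed[OF r x(1)]] key[OF that r] ract_closed[OF that x(1)]
      by simp
    show "\<exists>s\<in>carrier R. s \<odot>\<^bsub>M\<^esub> x \<in> ?c (r \<odot>\<^bsub>M\<^esub> x) \<and> r \<odot>\<^bsub>M\<^esub> b = s \<odot>\<^bsub>M\<^esub> b" using iff r by blast
    show "y = r \<odot>\<^bsub>M\<^esub> b" if "\<exists>s\<in>carrier R. s \<odot>\<^bsub>M\<^esub> x \<in> ?c (r \<odot>\<^bsub>M\<^esub> x) \<and> y = s \<odot>\<^bsub>M\<^esub> b" for y
      using that iff by blast
  qed
  have rep: "\<exists>r\<in>carrier R. X = ?c (r \<odot>\<^bsub>M\<^esub> x)" if "X \<in> carrier (quot_module M A)" for X
  proof -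
    from that obtain m where m: "m \<in> carrier M" "X = ?c m" by (auto simp: carrier_quot_module)
    obtain a r where ar: "a \<in> A" "r \<in> carrier R" "m = a \<oplus>\<^bsub>M\<^esub> r \<odot>\<^bsub>M\<^esub> x"
      using maximal_submodule_decompose[OF A x m(1)] .
    have "a \<in> carrier M" using ar(1) submoduleD(1)[OF As(1)] by blast
    then have "m \<ominus>\<^bsub>M\<^esub> r \<odot>\<^bsub>M\<^esub> x \<in> A"
      using ar x(1) ract_closed by (simp add: M.minus_eq M.a_assoc M.r_neg)
    then show ?thesis using m ar(2) coset_eq_iff[OF As(1) m(1) ract_closed[OF ar(2) x(1)]] by blast
  qed
  have mem: "?c (r \<odot>\<^bsub>M\<^esub> x) \<in> carrier (quot_module M A)" if "r \<in> carrier R" for r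
    using that x(1) ract_closed by (simp add: carrier_quot_module)
  have hom: "h \<in> rmod_hom R (quot_module M A) (M\<lparr>carrier := B\<rparr>)"
  proof (rule rmod_homI)
    fix X assume "X \<in> carrier (quot_module M A)"
    then obtain r where r: "r \<in> carrier R" "X = ?c (r \<odot>\<^bsub>M\<^esub> x)" using rep by blast
    then show "h X \<in> carrier (M\<lparr>carrier := B\<rparr>)" using h Bs(5) b by simp
    show "h (a \<odot>\<^bsub>quot_module M A\<^esub> X) = a \<odot>\<^bsub>M\<lparr>carrier := B\<rparr>\<^esub> h X" if a: "a \<in> carrier R" for a
    proof -
      have "a \<odot>\<^bsub>quot_module M A\<^esub> X = ?c ((r \<otimes>\<^bsub>R\<^esub> a) \<odot>\<^bsub>M\<^esub> x)"
        using r a x(1) by (simp add: ract_quot_module[OF As(1)] ract_closed ract_assoc)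
      then show ?thesis using h[of "r \<otimes>\<^bsub>R\<^esub> a"] h[of r] r a bM by (simp add: ract_assoc)
    qed
    show "h (X \<oplus>\<^bsub>quot_module M A\<^esub> Y) = h X \<oplus>\<^bsub>M\<lparr>carrier := B\<rparr>\<^esub> h Y"
      if "Y \<in> carrier (quot_module M A)" for Y
    proof -
      from rep[OF that] obtain s where s: "s \<in> carrier R" "Y = ?c (s \<odot>\<^bsub>M\<^esub> x)" by blast
      have "X \<oplus>\<^bsub>quot_module M A\<^esub> Y = ?c ((r \<oplus>\<^bsub>R\<^esub> s) \<odot>\<^bsub>M\<^esub> x)"
        using r s x(1) by (simp add: add_quot_module[OF As(1)] ract_closed ract_l_distr)
      then show ?thesis
        using h[of "r \<oplus>\<^bsub>R\<^esub> s"] h[of r] h[of s] r s bM by (simp add: ract_l_distr)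
    qed
  qed
  have "bij_betw h (carrier (quot_module M A)) (carrier (M\<lparr>carrier := B\<rparr>))"
    unfolding bij_betw_def
  proof
    show "inj_on h (carrier (quot_module M A))"
    proof (rule inj_onI)
      fix X Y assume XY: "X \<in> carrier (quot_module M A)" "Y \<in> carrier (quot_module M A)" "h X = h Y"
      obtain r s where "r \<in> carrier R" "X = ?c (r \<odot>\<^bsub>M\<^esub> x)" "s \<in> carrier R" "Y = ?c (s \<odot>\<^bsub>M\<^esub> x)"
        using rep[OF XY(1)] rep[OF XY(2)] by blast
      then show "X = Y" using XY(3) h key x(1) by (simp add: coset_eq_iff[OF As(1)] ract_closed)
    qed
    have "y \<in> h ` carrier (quot_module M A)" if "y \<in> B" for y
    proof -
      from simple_submodule_cyclic[OF B b that]
      obtain r where "r \<in> carrier R" "y = r \<odot>\<^bsub>M\<^esub> b" .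
      then show ?thesis using h mem by (metis imageI)
    qed
    moreover have "h X \<in> B" if "X \<in> carrier (quot_module M A)" for X
      using rmod_homD(1)[OF hom that] by simp
    ultimately show "h ` carrier (quot_module M A) = carrier (M\<lparr>carrier := B\<rparr>)"
      by auto
  qed
  then show ?thesis unfolding rmod_isomorphic_def using hom by blast
qed

text \<open>\<open>M/K\<close> is a vector space over the division ring \<open>R/J\<close>, and the
  result is a hyperplane in it. For \<open>N\<close> maximal above \<open>K\<close> among submodules
  missing \<open>x\<close>, each \<open>y\<close> outside \<open>N\<close> satisfies
  \<open>x = n \<oplus> r \<odot> y\<close> with \<open>r\<close> outside \<open>J\<close>. As
  \<open>r\<close> is a unit, \<open>y\<close> lies in every submodule containing \<open>N\<close>
  and \<open>x\<close>.\<close>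

lemma exists_maximal_submodule:
  assumes K: "submodule K R M" "K \<noteq> carrier M"
    and KJ: "\<And>a x. a \<in> J \<Longrightarrow> x \<in> carrier M \<Longrightarrow> a \<odot>\<^bsub>M\<^esub> x \<in> K"
  obtains N where "maximal_submodule N R M" "K \<subseteq> N"
proof -
  obtain x where x: "x \<in> carrier M" "x \<notin> K" using K submoduleD(1)[OF K(1)] by blast
  obtain N where N: "submodule N R M" "K \<subseteq> N" "x \<notin> N"
    and max: "\<And>L. submodule L R M \<Longrightarrow> N \<subseteq> L \<Longrightarrow> x \<notin> L \<Longrightarrow> L = N"
    using exists_maximal_avoiding[OF K(1) x(2)] by metis
  have "L = N \<or> L = carrier M" if L: "submodule L R M" "N \<subseteq> L" for L
  proof (cases "x \<in> L")
    case True
    have "y \<in> L" if y: "y \<in> carrier M" "y \<notin> N" for y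
    proof -
      let ?C = "(\<lambda>a. a \<odot>\<^bsub>M\<^esub> y) ` carrier R"
      have C: "submodule ?C R M" by (rule submodule_cyclic[OF y(1)])
      note NC = submodule_add[OF N(1) C]
      have "y \<in> ?C" using ract_one[OF y(1)] by (metis one_closed imageI)
      then have "x \<in> N <+>\<^bsub>M\<^esub> ?C" using max[OF NC(1,2)] NC(3) y(2) by blast
      then obtain n r where nr: "n \<in> N" "r \<in> carrier R" "x = n \<oplus>\<^bsub>M\<^esub> r \<odot>\<^bsub>M\<^esub> y"
        unfolding mem_set_add_iff by blast
      have "r \<notin> J"
      proof
        assume "r \<in> J"
        then have "r \<odot>\<^bsub>M\<^esub> y \<in> N" using KJ y(1) N(2) by blast
        then show False using nr N(3) submoduleD(3)[OF N(1)] by simp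
      qed
      have nM: "n \<in> carrier M" using nr(1) submoduleD(1)[OF N(1)] by blast
      have "r \<odot>\<^bsub>M\<^esub> y = x \<ominus>\<^bsub>M\<^esub> n"
        using nM nr(2,3) y(1) ract_closed by (simp add: M.minus_eq M.a_ac M.r_neg M.r_neg1 M.r_neg2)
      also have "\<dots> \<in> L" using submodule_diff[OF L(1) True] nr(1) L(2) by blast
      finally show ?thesis using unit_ract_cancel[OF L(1) unit_notin_J y(1)] nr(2) \<open>r \<notin> J\<close> by blast
    qed
    then show ?thesis using L submoduleD(1)[OF L(1)] by blast
  qed (use max L in blast)
  then have "maximal_submodule N R M" unfolding maximal_submodule_def using N x by blast
  then show ?thesis using that N(2) by blast
qed

end

section \<open>The equivalence\<close>

lemma (in local_ring_radical) exists_maximal_superset_soc: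
  fixes M :: "('a, 'b, 'd) module_scheme"
  assumes inf: "infinite (UNIV :: 'u set)" and lep: "carrier R \<lesssim> (UNIV :: 'u set)"
    and perfect: "right_perfect TYPE('u) R" and M: "right_module R M" and soc: "soc R M \<noteq> carrier M"
  obtains N where "maximal_submodule N R M" "soc R M \<subseteq> N"
proof -
  interpret right_module R M by (rule M)
  interpret local_ring_module R J M by unfold_locales
  let ?JK = "\<lambda>N. \<forall>a\<in>J. \<forall>x\<in>carrier M. a \<odot>\<^bsub>M\<^esub> x \<in> N"
  \<comment> \<open>The submodule generated by all products with elements of \<open>J\<close>. A
    maximal submodule above the socle and \<open>MJ\<close> will exist once their sum
    \<open>?K\<close> is proper.\<close>
  define MJ where "MJ = \<Inter>{N. submodule N R M \<and> ?JK N}"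
  have JM: "?JK (carrier M)" using J_subset ract_closed by blast
  have MJ: "submodule MJ R M"
    unfolding MJ_def by (rule submodule_Inter) (use submodule_carrier JM in blast)+
  have MJ_mem: "a \<odot>\<^bsub>M\<^esub> x \<in> MJ" if "a \<in> J" "x \<in> carrier M" for a x
    using that unfolding MJ_def by blast
  have MJ_least: "MJ \<subseteq> N" if "submodule N R M" "?JK N" for N using that unfolding MJ_def by blast
  let ?K = "soc R M <+>\<^bsub>M\<^esub> MJ"
  note K = submodule_add[OF submodule_soc MJ]
  have "?K \<noteq> carrier M"
  proof
    assume eq: "?K = carrier M"
    interpret MJ: right_module R "M\<lparr>carrier := MJ\<rparr>" by (rule right_module_restrict[OF MJ])
    have "radical_full R J (M\<lparr>carrier := MJ\<rparr>)"
      unfolding radical_full_def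
    proof (intro allI impI)
      fix L assume "submodule L R (M\<lparr>carrier := MJ\<rparr>)"
        and "\<forall>a\<in>J. \<forall>x\<in>carrier (M\<lparr>carrier := MJ\<rparr>). a \<odot>\<^bsub>M\<lparr>carrier := MJ\<rparr>\<^esub> x \<in> L"
      then have L: "submodule L R M" "L \<subseteq> MJ" and LJ: "\<And>a x. a \<in> J \<Longrightarrow> x \<in> MJ \<Longrightarrow> a \<odot>\<^bsub>M\<^esub> x \<in> L"
        using submodule_restrict_iff[OF MJ] by auto
      \<comment> \<open>The elements that \<open>J\<close> sends into \<open>L\<close>, a submodule
        because \<open>J\<close> is a left ideal. It contains the socle, which \<open>J\<close>
        annihilates, and it contains \<open>MJ\<close> by the choice of \<open>L\<close>. So it is
        all of \<open>M\<close>, whence \<open>MJ \<subseteq> L\<close>.\<close>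
      let ?Q = "{m \<in> carrier M. \<forall>j\<in>J. j \<odot>\<^bsub>M\<^esub> m \<in> L}"
      note Ls = submoduleD[OF L(1)]
      have Q: "submodule ?Q R M"
      proof (rule submoduleI)
        show "\<zero>\<^bsub>M\<^esub> \<in> ?Q" using Ls(2) J_right_ideal(1) by simp
        show "x \<oplus>\<^bsub>M\<^esub> y \<in> ?Q" if "x \<in> ?Q" "y \<in> ?Q" for x y
          using that Ls(3) J_right_ideal(1) by (simp add: ract_r_distr)
        show "a \<odot>\<^bsub>M\<^esub> x \<in> ?Q" if a: "a \<in> carrier R" "x \<in> ?Q" for a x
        proof -
          have "j \<odot>\<^bsub>M\<^esub> (a \<odot>\<^bsub>M\<^esub> x) \<in> L" if "j \<in> J" for j
          proof -
            have "j \<odot>\<^bsub>M\<^esub> (a \<odot>\<^bsub>M\<^esub> x) = (a \<otimes>\<^bsub>R\<^esub> j) \<odot>\<^bsub>M\<^esub> x"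
              using a that J_right_ideal(1) by (simp add: ract_assoc)
            then show ?thesis using a J_left_ideal[OF a(1) that] by simp
          qed
          then show ?thesis using a ract_closed by simp
        qed
      qed blast
      have "soc R M \<subseteq> ?Q"
      proof (rule soc_least[OF Q])
        fix B assume B: "simple_submodule B R M"
        show "B \<subseteq> ?Q" using simple_submoduleD(2)[OF B] simple_ract_J[OF B] Ls(2) by auto
      qed
      moreover have "MJ \<subseteq> ?Q"
        using MJ_mem LJ J_subset ract_closed by (intro MJ_least[OF Q]) auto
      ultimately have "?K \<subseteq> ?Q" by (rule set_add_subset[OF Q])
      then have "MJ \<subseteq> L" unfolding eq by (intro MJ_least[OF L(1)]) blast
      then show "L = carrier (M\<lparr>carrier := MJ\<rparr>)" using L(2) by simp
    qed
    then have "MJ = {\<zero>\<^bsub>M\<^esub>}"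
      using perfect_full_zero[OF inf lep perfect MJ.right_module_axioms] by simp
    then have "?K \<subseteq> soc R M"
      using submoduleD(2)[OF submodule_soc] by (intro set_add_subset[OF submodule_soc]) auto
    then show False using eq soc soc_subset_carrier by blast
  qed
  then show ?thesis
    using exists_maximal_submodule[OF K(1)] K(2,3) MJ_mem that by (metis subset_iff)
qed

theorem corollary3:
  fixes R :: "('a, 'c) ring_scheme"
    and M :: "('a, 'm, 'd) module_scheme"
  assumes "infinite (UNIV :: 'u set)"
    and "carrier R \<lesssim> (UNIV :: 'u set)"
    and "local_ring R"
    and "right_perfect TYPE('u) R"
    and "right_module R M"
  shows "simple_direct_projective R M \<longleftrightarrow>
    semisimple_rmodule R M \<or> soc R M \<subseteq> rad R M"
proof -
  interpret right_module R M by fact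
  obtain J where "maximal_submodule J R (right_regular R)"
    "\<And>I. maximal_submodule I R (right_regular R) \<Longrightarrow> I = J"
    using assms(3) unfolding local_ring_def by metis
  then interpret local_ring_module R J M
    by (intro local_ring_module.intro local_ring_radical.intro local_ring_radical_axioms.intro
        R.ring_axioms right_module_axioms)
  show ?thesis
  proof
    assume sdp: "simple_direct_projective R M"
    show "semisimple_rmodule R M \<or> soc R M \<subseteq> rad R M"
    proof (rule ccontr)
      assume "\<not> ?thesis"
      then have neq: "soc R M \<noteq> carrier M" and "\<not> soc R M \<subseteq> rad R M"
        by (auto simp: semisimple_rmodule_def)
      then obtain N where N: "maximal_submodule N R M" "\<not> soc R M \<subseteq> N"
        using soc_subset_carrier unfolding rad_def by blast
      then have "submodule N R M" by (simp add: maximal_submodule_def)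
      \<comment> \<open>By \<open>soc_least\<close>, a submodule that does not contain the socle
        misses some simple submodule.\<close>
      then obtain B where B: "simple_submodule B R M" "\<not> B \<subseteq> N"
        using soc_least N(2) by blast
      obtain A where A: "maximal_submodule A R M" "soc R M \<subseteq> A"
        using exists_maximal_superset_soc[OF assms(1,2,4,5) neq] by blast
      have As: "submodule A R M" "A \<noteq> carrier M" using A(1) by (simp_all add: maximal_submodule_def)
      have "direct_summand A R M"
        using sdp As(1) B(1) maximal_quotient_isomorphic_simple[OF A(1) B(1)]
          direct_summand_simple_maximal[OF N(1) B] unfolding simple_direct_projective_def by blast
      then obtain C where C: "submodule C R M" "A \<inter> C = {\<zero>\<^bsub>M\<^esub>}" "A <+>\<^bsub>M\<^esub> C = carrier M"
        unfolding direct_summand_def by blast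
      have Cs: "simple_submodule C R M" by (rule complement_maximal_simple[OF A(1) C])
      then have "C \<subseteq> A" using simple_subset_soc A(2) by blast
      then have "C = {\<zero>\<^bsub>M\<^esub>}" using C(2) by blast
      then show False using Cs by (simp add: simple_submodule_iff)
    qed
  next
    assume rhs: "semisimple_rmodule R M \<or> soc R M \<subseteq> rad R M"
    show "simple_direct_projective R M"
      unfolding simple_direct_projective_def
    proof (intro allI impI, elim conjE)
      fix A B assume A: "submodule A R M" and B: "simple_submodule B R M"
        and iso: "rmod_isomorphic R (quot_module M A) (M\<lparr>carrier := B\<rparr>)"
        and summand: "direct_summand B R M"
      show "direct_summand A R M"
        using rhs
      proof
        assume "semisimple_rmodule R M"
        then show ?thesis
          using semisimple_direct_summand[OF _ A B iso] by (simp add: semisimple_rmodule_def)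
      next
        assume soc: "soc R M \<subseteq> rad R M"
        obtain C where C: "submodule C R M" "B \<inter> C = {\<zero>\<^bsub>M\<^esub>}" "B <+>\<^bsub>M\<^esub> C = carrier M"
          using summand unfolding direct_summand_def by blast
        \<comment> \<open>A maximal complement of \<open>B\<close> would contain the radical, hence
          the socle, hence \<open>B\<close> itself.\<close>
        have "maximal_submodule C R M" by (rule complement_simple_maximal[OF B C])
        then have "B \<subseteq> C" using soc simple_subset_soc[OF B] unfolding rad_def by blast
        then have "B = {\<zero>\<^bsub>M\<^esub>}" using C(2) by blast
        then show ?thesis using B by (simp add: simple_submodule_iff)
      qed
    qed
  qed
qed

end
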